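(* Let $P$ be a transition matrix on a countable state space $S$ and let $\mu$ and $\nu$ be supercritical offspring distributions with means $\bar\mu<\bar\nu$. Then every $\nu$-transient set $A\subseteq S$ is $\mu$-transient, and every $\mu$-recurrent set $A\subseteq S$ is $\nu$-recurrent.
   Context: $S$ is a countable (nonempty) set and $P$ is the transition matrix of a Markov chain on $S$. An offspring distribution is a probability measure $\mu$ on $\{0,1,2,\ldots\}$; its mean is $\bar\mu=\sum_{n\ge 0} n\mu(n)\in[0,\infty]$, and $\mu$ is supercritical if $\bar\mu>1$. The branching Markov process $(B_n)_{n\ge 0}$ associated to $(P,\mu)$ takes values in finitely supported functions $S\to\{0,1,2,\ldots\}$, where $B_n(y)$ is the number of particles at state $y$ at time $n$. It starts from a single particle at some $x\in S$. At each time step, each particle is independently replaced by a random number of new particles with law $\mu$, and each new particle immediately performs an independent step of the Markov chain with transition matrix $P$ from its parent's location. Its law is denoted $\mathbf{P}_x^\mu$. For $A\subseteq S$, $L(A)=\sum_{a\in A}\sum_{n\ge 0}B_n(a)\in[0,\infty]$ is the total number of particles that ever visit $A$. $\Omega_\infty$ is the event that the process survives forever, i.e. $\sum_{y\in S}B_n(y)>0$ for every $n$. A set $A\subseteq S$ is $\mu$-recurrent if for every $x\in S$ we have $\mathbf{P}_x^\mu(\Omega_\infty)>0$ and $\mathbf{P}_x^\mu(L(A)=\infty\mid\Omega_\infty)=1$. A set $A\subseteq S$ is $\mu$-transient if $\mathbf{P}_x^\mu(L(A)=\infty)=0$ for every $x\in S$. *)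

theory Defs
  imports "HOL-Probability.Probability"
begin

text \<open>
  The state space is a type of class \<open>countable\<close>, and a transition matrix on it is a map
  \<open>P :: 's \<Rightarrow> 's pmf\<close>, with entries \<open>pmf (P x) y\<close>.
  A particle configuration, i.e. a finitely supported function from states to naturals,
  is a multiset \<open>B\<close> of states: \<open>count B y\<close> is the number of particles at \<open>y\<close>, and \<open>size B\<close>
  is the total number of particles.
\<close>

definition offspring_mean :: "nat pmf \<Rightarrow> ennreal" where
  "offspring_mean \<mu> = (\<Sum>n. of_nat n * ennreal (pmf \<mu> n))"

definition supercritical :: "nat pmf \<Rightarrow> bool" where
  "supercritical \<mu> \<longleftrightarrow> offspring_mean \<mu> > 1"

definition offspring_law :: "('s \<Rightarrow> 's pmf) \<Rightarrow> nat pmf \<Rightarrow> 's \<Rightarrow> 's multiset pmf" where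
  "offspring_law P \<mu> x = bind_pmf \<mu> (\<lambda>n. map_pmf mset (replicate_pmf n (P x)))"

definition add_indep :: "'s multiset pmf \<Rightarrow> 's multiset pmf \<Rightarrow> 's multiset pmf" where
  "add_indep p q = map_pmf (\<lambda>(C, D). C + D) (pair_pmf p q)"

text \<open>The convolution of the offspring laws of all particles of \<open>B\<close>; the order of the
  particles is irrelevant by \<open>comp_fun_commute_offspring\<close> below.\<close>

definition branching_step :: "('s \<Rightarrow> 's pmf) \<Rightarrow> nat pmf \<Rightarrow> 's multiset \<Rightarrow> 's multiset pmf" where
  "branching_step P \<mu> B = fold_mset (\<lambda>x. add_indep (offspring_law P \<mu> x)) (return_pmf {#}) B"

lemma add_indep_left_commute: "add_indep p (add_indep q r) = add_indep q (add_indep p r)"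
proof -
  have "add_indep p (add_indep q r) =
      bind_pmf p (\<lambda>a. bind_pmf q (\<lambda>b. bind_pmf r (\<lambda>c. return_pmf (a + (b + c)))))" for p q
    by (simp add: add_indep_def pair_pmf_def map_pmf_def bind_assoc_pmf bind_return_pmf)
  then show ?thesis
    by (simp add: bind_commute_pmf[of p q] add.left_commute)
qed

lemma comp_fun_commute_offspring: "comp_fun_commute (\<lambda>x. add_indep (offspring_law P \<mu> x))"
  by standard (simp add: fun_eq_iff add_indep_left_commute)

lemma branching_step_empty: "branching_step P \<mu> {#} = return_pmf {#}"
  by (simp add: branching_step_def)

lemma branching_step_add_mset:
  "branching_step P \<mu> (add_mset x B) = add_indep (offspring_law P \<mu> x) (branching_step P \<mu> B)"
  by (simp add: branching_step_def
      comp_fun_commute.fold_mset_add_mset[OF comp_fun_commute_offspring])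

text \<open>The law of \<open>B n\<close> given \<open>B 0, \<dots>, B (n - 1)\<close> for the process started from a single
  particle at \<open>x\<close>.\<close>

fun branching_kernel ::
    "('s \<Rightarrow> 's pmf) \<Rightarrow> nat pmf \<Rightarrow> 's \<Rightarrow> nat \<Rightarrow> (nat \<Rightarrow> 's multiset) \<Rightarrow> 's multiset measure" where
  "branching_kernel P \<mu> x 0 B = measure_pmf (return_pmf {#x#})"
| "branching_kernel P \<mu> x (Suc n) B = measure_pmf (branching_step P \<mu> (B n))"

lemma Ionescu_Tulcea_branching_kernel:
  "Ionescu_Tulcea (branching_kernel P \<mu> x) (\<lambda>_. count_space UNIV)"
proof (rule Ionescu_Tulcea.intro)
  fix i :: nat and B
  show "prob_space (branching_kernel P \<mu> x i B)"
    by (cases i) (simp_all add: measure_pmf.prob_space_axioms)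
  show "branching_kernel P \<mu> x i \<in> PiM {0..<i} (\<lambda>_. count_space UNIV)
      \<rightarrow>\<^sub>M subprob_algebra (count_space UNIV)"
  proof (cases i)
    case 0
    have "branching_kernel P \<mu> x 0 = (\<lambda>_. measure_pmf (return_pmf {#x#}))"
      by (simp add: fun_eq_iff)
    then show ?thesis
      unfolding 0 by (auto simp: space_subprob_algebra measure_pmf.subprob_space_axioms)
  next
    case (Suc n)
    have "(\<lambda>C. measure_pmf (branching_step P \<mu> C))
        \<in> count_space UNIV \<rightarrow>\<^sub>M subprob_algebra (count_space UNIV)"
      by (auto simp: space_subprob_algebra measure_pmf.subprob_space_axioms)
    moreover have "(\<lambda>B. B n) \<in> PiM {0..<i} (\<lambda>_. count_space UNIV) \<rightarrow>\<^sub>M count_space UNIV"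
      by (rule measurable_component_singleton) (simp add: Suc)
    moreover have "branching_kernel P \<mu> x (Suc n) = (\<lambda>B. measure_pmf (branching_step P \<mu> (B n)))"
      by (simp add: fun_eq_iff)
    ultimately show ?thesis
      using Suc by (auto intro: measurable_compose)
  qed
qed

interpretation branching: Ionescu_Tulcea "branching_kernel P \<mu> x" "\<lambda>_. count_space UNIV"
  for P :: "'s \<Rightarrow> 's pmf" and \<mu> :: "nat pmf" and x :: 's
  by (rule Ionescu_Tulcea_branching_kernel)

text \<open>The law of the branching Markov process on trajectories \<open>B :: nat \<Rightarrow> 's multiset\<close>, given by
  the Ionescu-Tulcea construction.\<close>

definition branching_law ::
    "('s \<Rightarrow> 's pmf) \<Rightarrow> nat pmf \<Rightarrow> 's \<Rightarrow> (nat \<Rightarrow> 's multiset) measure" where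
  "branching_law P \<mu> x = branching.PF.lim P \<mu> x"

definition total_visits :: "'s set \<Rightarrow> (nat \<Rightarrow> 's multiset) \<Rightarrow> ennreal" where
  "total_visits A B = (\<Sum>\<^sub>\<infinity>a\<in>A. \<Sum>n. of_nat (count (B n) a))"

definition survives :: "(nat \<Rightarrow> 's multiset) \<Rightarrow> bool" where
  "survives B \<longleftrightarrow> (\<forall>n. size (B n) > 0)"

definition recurrent_set :: "('s \<Rightarrow> 's pmf) \<Rightarrow> nat pmf \<Rightarrow> 's set \<Rightarrow> bool" where
  "recurrent_set P \<mu> A \<longleftrightarrow>
    (\<forall>x. \<P>(B in branching_law P \<mu> x. survives B) > 0 \<and>
         \<P>(B in branching_law P \<mu> x. total_visits A B = \<infinity> \<bar> survives B) = 1)"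

definition transient_set :: "('s \<Rightarrow> 's pmf) \<Rightarrow> nat pmf \<Rightarrow> 's set \<Rightarrow> bool" where
  "transient_set P \<mu> A \<longleftrightarrow>
    (\<forall>x. \<P>(B in branching_law P \<mu> x. total_visits A B = \<infinity>) = 0)"

lemma sets_branching_law [measurable_cong]:
  "sets (branching_law P \<mu> x) = sets (PiM UNIV (\<lambda>_. count_space UNIV))"
  by (simp add: branching_law_def)

lemma prob_space_branching_law: "prob_space (branching_law P \<mu> x)"
proof
  interpret CI: prob_space "branching.CI P \<mu> x {}"
    by (rule branching.PF.prob_space_P) auto
  have "emeasure (branching_law P \<mu> x)
      (branching.PF.emb UNIV {} (space (PiM {} (\<lambda>_. count_space UNIV)))) = 1"
    unfolding branching_law_def
    using CI.emeasure_space_1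
    by (subst branching.lim) (auto simp: branching.CI_def)
  then show "emeasure (branching_law P \<mu> x) (space (branching_law P \<mu> x)) = 1"
    by (simp add: branching_law_def prod_emb_def space_PiM PiE_UNIV_domain restrict_def vimage_def)
qed

lemma measurable_survives [measurable]:
  "Measurable.pred (PiM UNIV (\<lambda>_. count_space UNIV)) survives"
proof -
  have "(\<lambda>B. B n) \<in> PiM UNIV (\<lambda>_. count_space UNIV) \<rightarrow>\<^sub>M count_space UNIV" for n :: nat
    by (rule measurable_component_singleton) simp
  then have "Measurable.pred (PiM UNIV (\<lambda>_. count_space UNIV)) (\<lambda>B. size (B n) > 0)" for n :: nat
    by (rule measurable_compose) simp
  then show ?thesis
    unfolding survives_def[abs_def] by measurable
qed

lemma measurable_total_visits [measurable]:
  fixes A :: "'s::countable set"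
  shows "total_visits A \<in> borel_measurable (PiM UNIV (\<lambda>_. count_space UNIV))"
proof -
  have "(\<lambda>B :: nat \<Rightarrow> 's multiset. B n)
      \<in> PiM UNIV (\<lambda>_. count_space UNIV) \<rightarrow>\<^sub>M count_space UNIV" for n
    by (rule measurable_component_singleton) simp
  then have [measurable]: "(\<lambda>B :: nat \<Rightarrow> 's multiset. of_nat (count (B n) a) :: ennreal)
      \<in> borel_measurable (PiM UNIV (\<lambda>_. count_space UNIV))" for n and a :: 's
    by (rule measurable_compose) simp
  have "countable {F. finite F \<and> F \<subseteq> A}"
    using countable_Collect_finite_subset[of A] by (simp add: conj_commute)
  then show ?thesis
    unfolding total_visits_def[abs_def]
    by (subst nonneg_infsum_complete) (auto intro!: borel_measurable_SUP)
qed

end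

theory Submission
  imports Defs
begin

text \<open>
  Write \<open>G\<close> for the generating function of an offspring law and \<open>L\<close> for the total number of visits to
  \<open>A\<close>. For \<open>0 < q < 1\<close> the mean \<open>E\<^sub>x[q ^ L]\<close> (with \<open>q ^ \<infinity> = 0\<close>) is the decreasing limit of
  the iterates, started from the constant 1, of
    \<open>h \<mapsto> (\<lambda>x. a x * G (\<Sum>\<^sub>y P x y * h y))\<close>, where \<open>a = q\<close> on \<open>A\<close> and \<open>a = 1\<close> off \<open>A\<close>,
  and as \<open>q\<close> tends to 1 it tends to the probability that \<open>L\<close> is finite. Everything about the process
  that the theorem needs is in this iteration.

  The means enter only through the behaviour of \<open>G\<close> near 1: if the mean of \<open>\<mu>\<close> is less than the mean
  of \<open>\<nu>\<close>, then \<open>1 - G\<^sub>\<mu> (1 - t) < 1 - G\<^sub>\<nu> (1 - t)\<close> for all small \<open>t > 0\<close> (\<open>germ_order\<close>). This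
  compares only the germs at 1 of the two functions, which is much weaker than stochastic domination, so
  that the two processes cannot be coupled in general. The idea is to pay for the restricted range of
  \<open>t\<close> by a constant factor. Let \<open>U = 1 - E\<^sup>\<mu>[q ^ L]\<close> and \<open>V = 1 - E\<^sup>\<nu>[q ^ L]\<close>, and let \<open>\<delta>\<close> be
  a small constant. Then \<open>\<delta> * U \<le> V\<close> everywhere: where \<open>V \<ge> \<delta>\<close> this is trivial, and where \<open>V < \<delta>\<close> the
  average of \<open>V\<close> over the next step is so small that the comparison of generating functions applies,
  while concavity of \<open>t \<mapsto> 1 - G\<^sub>\<mu> (1 - t)\<close> lets the factor \<open>1 / \<delta>\<close> pass through one step of the
  iteration (\<open>germ_scalar_comparison\<close>). The constant does not depend on \<open>q\<close>, so in the limit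
    \<open>\<delta> * P\<^sub>x\<^sup>\<mu>(L = \<infinity>) \<le> P\<^sub>x\<^sup>\<nu>(L = \<infinity>)\<close> for all \<open>x\<close> (\<open>infinite_visits_comparison\<close>),
  which settles transience.

  For recurrence, if \<open>A\<close> is \<open>\<mu>\<close>-recurrent then \<open>P\<^sub>x\<^sup>\<mu>(L = \<infinity>)\<close> is the survival probability, which
  supercriticality bounds away from 0 uniformly in \<open>x\<close> (\<open>supercritical_survival\<close>); the inequality then
  does the same for \<open>P\<^sub>x\<^sup>\<nu>(L = \<infinity>)\<close>. Both \<open>P\<^sub>x\<^sup>\<nu>(L < \<infinity>)\<close> and the extinction
  probability are fixed points of \<open>h \<mapsto> (\<lambda>x. G\<^sub>\<nu> (\<Sum>\<^sub>y P x y * h y))\<close>, and for a supercritical law there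
  is only one fixed point that is bounded away from 1, because \<open>G\<close> is convex
  (\<open>supercritical_subinvariant_le_superinvariant\<close>). Hence \<open>L = \<infinity>\<close> almost surely on survival. Extinction
  itself is the case \<open>A = UNIV\<close>: the process survives exactly when \<open>L(UNIV) = \<infinity>\<close>, up to a null set.
\<close>

section \<open>Probability generating functions\<close>

definition pgf :: "nat pmf \<Rightarrow> real \<Rightarrow> real" where
  "pgf \<mu> z = measure_pmf.expectation \<mu> (\<lambda>n. z ^ n)"

lemma integrable_pmf_unit:
  fixes f :: "'a \<Rightarrow> real"
  assumes "\<And>x. 0 \<le> f x \<and> f x \<le> 1"
  shows "integrable (measure_pmf p) f"
  using assms by (intro measure_pmf.integrable_const_bound[where B = 1]) auto

lemma expectation_pmf_unit:
  fixes f :: "'a \<Rightarrow> real"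
  assumes "\<And>x. 0 \<le> f x \<and> f x \<le> 1"
  shows "0 \<le> measure_pmf.expectation p f" "measure_pmf.expectation p f \<le> 1"
proof -
  show "0 \<le> measure_pmf.expectation p f"
    using assms by (intro integral_nonneg_AE) auto
  have "measure_pmf.expectation p f \<le> measure_pmf.expectation p (\<lambda>_. 1)"
    using assms by (intro integral_mono integrable_pmf_unit) auto
  then show "measure_pmf.expectation p f \<le> 1"
    by simp
qed

lemma expectation_pmf_mono:
  fixes f g :: "'a \<Rightarrow> real"
  assumes "\<And>x. 0 \<le> f x" "\<And>x. f x \<le> g x" "\<And>x. g x \<le> 1"
  shows "measure_pmf.expectation p f \<le> measure_pmf.expectation p g"
  using assms by (intro integral_mono integrable_pmf_unit) (meson order_trans)+

lemma expectation_pmf_ge_const: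
  fixes f :: "'a \<Rightarrow> real"
  assumes "0 \<le> c" "\<And>x. c \<le> f x" "\<And>x. f x \<le> 1"
  shows "c \<le> measure_pmf.expectation p f"
  using expectation_pmf_mono[of "\<lambda>_. c" f p] assms by simp

lemma ennreal_expectation_pmf:
  fixes f :: "'a \<Rightarrow> real"
  assumes "\<And>x. 0 \<le> f x \<and> f x \<le> 1"
  shows "(\<integral>\<^sup>+x. ennreal (f x) \<partial>measure_pmf p) = ennreal (measure_pmf.expectation p f)"
  using assms by (intro nn_integral_eq_integral integrable_pmf_unit) auto

lemma expectation_pmf_one_minus:
  fixes f :: "'a \<Rightarrow> real"
  assumes "\<And>x. 0 \<le> f x \<and> f x \<le> 1"
  shows "measure_pmf.expectation p (\<lambda>x. 1 - f x) = 1 - measure_pmf.expectation p f"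
  using assms by (subst Bochner_Integration.integral_diff) (auto intro: integrable_pmf_unit)

lemma expectation_pmf_tendsto:
  fixes f :: "nat \<Rightarrow> 'a \<Rightarrow> real"
  assumes "\<And>n x. 0 \<le> f n x \<and> f n x \<le> 1" and "\<And>x. (\<lambda>n. f n x) \<longlonglongrightarrow> g x"
  shows "(\<lambda>n. measure_pmf.expectation p (f n)) \<longlonglongrightarrow> measure_pmf.expectation p g"
  using assms by (intro integral_dominated_convergence[where w = "\<lambda>_. 1"]) auto

lemma power_unit:
  fixes z :: real
  assumes "0 \<le> z" "z \<le> 1"
  shows "0 \<le> z ^ n \<and> z ^ n \<le> 1"
  using assms by (simp add: power_le_one)

lemma pgf_unit:
  assumes "0 \<le> z" "z \<le> 1"
  shows "0 \<le> pgf \<mu> z" "pgf \<mu> z \<le> 1"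
  unfolding pgf_def by (intro expectation_pmf_unit power_unit assms)+

lemma pgf_1 [simp]: "pgf \<mu> 1 = 1"
  by (simp add: pgf_def)

lemma pgf_mono:
  assumes "0 \<le> z" "z \<le> w" "w \<le> 1"
  shows "pgf \<mu> z \<le> pgf \<mu> w"
  unfolding pgf_def using assms by (intro expectation_pmf_mono power_mono) (auto simp: power_le_one)

lemma pgf_tendsto:
  assumes "\<And>n. 0 \<le> z n \<and> z n \<le> 1" and "z \<longlonglongrightarrow> w"
  shows "(\<lambda>n. pgf \<mu> (z n)) \<longlonglongrightarrow> pgf \<mu> w"
  unfolding pgf_def using assms by (intro expectation_pmf_tendsto power_unit tendsto_power) auto

lemma pgf_convex: "convex_on {0..1} (pgf \<mu>)"
proof (rule convex_onI)
  fix t x y :: real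
  assume t: "0 < t" "t < 1" and xy: "x \<in> {0..1}" "y \<in> {0..1}"
  have I: "integrable \<mu> (\<lambda>n. z ^ n)" if "z \<in> {0..1}" for z :: real
    using that by (intro integrable_pmf_unit power_unit) auto
  have c: "(1 - t) *\<^sub>R x + t *\<^sub>R y \<in> {0..1}"
    using t xy convexD[of "{0..1::real}" x y "1 - t" t] by auto
  have "pgf \<mu> ((1 - t) *\<^sub>R x + t *\<^sub>R y)
      \<le> measure_pmf.expectation \<mu> (\<lambda>n. (1 - t) * x ^ n + t * y ^ n)"
    unfolding pgf_def
  proof (intro integral_mono I c)
    show "integrable \<mu> (\<lambda>n. (1 - t) * x ^ n + t * y ^ n)"
      using I xy by auto
    show "((1 - t) *\<^sub>R x + t *\<^sub>R y) ^ n \<le> (1 - t) * x ^ n + t * y ^ n" for n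
    proof -
      have "convex_on {0..} (\<lambda>z::real. z ^ n)"
        by (cases "even n") (auto intro: convex_power_odd convex_on_subset[OF convex_power_even])
      from convex_onD[OF this, of t x y] show ?thesis
        using t xy by auto
    qed
  qed
  also have "\<dots> = (1 - t) * pgf \<mu> x + t * pgf \<mu> y"
    unfolding pgf_def using I xy by simp
  finally show "pgf \<mu> ((1 - t) *\<^sub>R x + t *\<^sub>R y) \<le> (1 - t) * pgf \<mu> x + t * pgf \<mu> y" .
qed simp

text \<open>
  Concavity of \<open>t \<mapsto> 1 - pgf \<mu> (1 - t)\<close>, which vanishes at 0: enlarging the argument by a factor
  enlarges the value by at most that factor.
\<close>

lemma pgf_scale:
  assumes "0 \<le> t" "1 \<le> c" "c * t \<le> 1"
  shows "1 - pgf \<mu> (1 - c * t) \<le> c * (1 - pgf \<mu> (1 - t))"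
proof -
  have "pgf \<mu> ((1 - 1 / c) *\<^sub>R 1 + (1 / c) *\<^sub>R (1 - c * t))
      \<le> (1 - 1 / c) * pgf \<mu> 1 + (1 / c) * pgf \<mu> (1 - c * t)"
    using assms by (intro convex_onD[OF pgf_convex]) auto
  moreover have arg: "(1 - 1 / c) *\<^sub>R 1 + (1 / c) *\<^sub>R (1 - c * t) = 1 - t"
    using assms by (simp add: field_simps)
  ultimately have "pgf \<mu> (1 - t) \<le> (1 - 1 / c) + (1 / c) * pgf \<mu> (1 - c * t)"
    unfolding arg pgf_1 by simp
  then have "c * pgf \<mu> (1 - t) \<le> c * ((1 - 1 / c) + (1 / c) * pgf \<mu> (1 - c * t))"
    using assms by (intro mult_left_mono) auto
  also have "\<dots> = c - 1 + pgf \<mu> (1 - c * t)"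
    using assms by (simp add: field_simps)
  finally show ?thesis
    by (simp add: algebra_simps)
qed

text \<open>
  As a sum in \<open>ennreal\<close>, the deficit of the generating function can be compared term by term with the
  mean, which may be infinite.
\<close>

lemma ennreal_one_minus_pgf:
  assumes "0 \<le> t" "t \<le> 1"
  shows "ennreal (1 - pgf \<mu> (1 - t)) = (\<Sum>n. ennreal (pmf \<mu> n) * ennreal (1 - (1 - t) ^ n))"
proof -
  have u: "0 \<le> (1 - t) ^ n \<and> (1 - t) ^ n \<le> 1" for n
    using assms by (intro power_unit) auto
  have "1 - pgf \<mu> (1 - t) = measure_pmf.expectation \<mu> (\<lambda>n. 1 - (1 - t) ^ n)"
    unfolding pgf_def using u by (subst expectation_pmf_one_minus) auto
  also have "ennreal \<dots> = (\<integral>\<^sup>+n. ennreal (1 - (1 - t) ^ n) \<partial>\<mu>)"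
    using u by (subst ennreal_expectation_pmf) auto
  also have "\<dots> = (\<Sum>n. ennreal (pmf \<mu> n) * ennreal (1 - (1 - t) ^ n))"
    by (subst nn_integral_measure_pmf) (simp add: nn_integral_count_space_nat)
  finally show ?thesis .
qed

lemma pgf_upper:
  assumes "0 \<le> t" "t \<le> 1"
  shows "ennreal (1 - pgf \<mu> (1 - t)) \<le> ennreal t * offspring_mean \<mu>"
proof -
  have b: "1 - (1 - t) ^ n \<le> t * real n" for n
    using Bernoulli_inequality[of "- t" n] assms by (simp add: algebra_simps)
  have "ennreal (1 - pgf \<mu> (1 - t)) \<le> (\<Sum>n. ennreal t * (of_nat n * ennreal (pmf \<mu> n)))"
    unfolding ennreal_one_minus_pgf[OF assms]
  proof (intro suminf_le allI)
    fix n
    have "ennreal (1 - (1 - t) ^ n) \<le> ennreal (t * real n)"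
      using b by (intro ennreal_leI)
    also have "\<dots> = ennreal t * of_nat n"
      using assms by (simp add: ennreal_mult ennreal_of_nat_eq_real_of_nat)
    finally have "ennreal (pmf \<mu> n) * ennreal (1 - (1 - t) ^ n)
        \<le> ennreal (pmf \<mu> n) * (ennreal t * of_nat n)"
      by (rule mult_left_mono) simp
    then show "ennreal (pmf \<mu> n) * ennreal (1 - (1 - t) ^ n)
        \<le> ennreal t * (of_nat n * ennreal (pmf \<mu> n))"
      by (simp add: mult_ac)
  qed auto
  then show ?thesis
    by (simp add: offspring_mean_def)
qed

text \<open>
  A truncated version of \<open>1 - pgf \<mu> (1 - t) \<approx> t * mean\<close>: for \<open>n < N\<close> every summand of
  \<open>1 - (1 - t) ^ n = t * (\<Sum>i<n. (1 - t) ^ i)\<close> is at least \<open>(1 - t) ^ N\<close>. The truncation keeps the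
  bound meaningful for laws of infinite mean.
\<close>

lemma pgf_lower:
  assumes "0 \<le> t" "t \<le> 1"
  shows "t * (1 - t) ^ N * (\<Sum>n<N. real n * pmf \<mu> n) \<le> 1 - pgf \<mu> (1 - t)"
proof -
  have b: "t * (1 - t) ^ N * real n \<le> 1 - (1 - t) ^ n" if "n < N" for n
  proof -
    have "(\<Sum>i<n. (1 - t) ^ N) \<le> (\<Sum>i<n. (1 - t) ^ i)"
      using assms that by (intro sum_mono power_decreasing) auto
    then have "t * (real n * (1 - t) ^ N) \<le> t * (\<Sum>i<n. (1 - t) ^ i)"
      using assms by (intro mult_left_mono) auto
    also have "\<dots> = 1 - (1 - t) ^ n"
      using one_diff_power_eq[of "1 - t" n] by simp
    finally show ?thesis
      by (simp add: algebra_simps)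
  qed
  have "ennreal (\<Sum>n<N. t * (1 - t) ^ N * (real n * pmf \<mu> n))
      = (\<Sum>n<N. ennreal (t * (1 - t) ^ N * (real n * pmf \<mu> n)))"
    using assms by (subst sum_ennreal) auto
  also have "\<dots> \<le> (\<Sum>n<N. ennreal (pmf \<mu> n) * ennreal (1 - (1 - t) ^ n))"
  proof (rule sum_mono)
    fix n assume "n \<in> {..<N}"
    then have "pmf \<mu> n * (t * (1 - t) ^ N * real n) \<le> pmf \<mu> n * (1 - (1 - t) ^ n)"
      using b[of n] by (intro mult_left_mono) auto
    then show "ennreal (t * (1 - t) ^ N * (real n * pmf \<mu> n))
        \<le> ennreal (pmf \<mu> n) * ennreal (1 - (1 - t) ^ n)"
      using assms power_unit[of "1 - t" n]
      by (subst ennreal_mult[symmetric]) (auto intro!: ennreal_leI simp: algebra_simps)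
  qed
  also have "\<dots> \<le> ennreal (1 - pgf \<mu> (1 - t))"
    unfolding ennreal_one_minus_pgf[OF assms] by (intro sum_le_suminf) auto
  finally show ?thesis
    using pgf_unit[of "1 - t" \<mu>] assms by (simp add: sum_distrib_left)
qed

text \<open>
  The deficit of \<open>\<mu>\<close> is at most \<open>t\<close> times its mean, and the deficit of \<open>\<nu>\<close> is close to \<open>t\<close> times a
  partial sum of its mean; some partial sum already exceeds the mean of \<open>\<mu>\<close>.
\<close>

lemma germ_order:
  assumes "offspring_mean \<mu> < offspring_mean \<nu>"
  obtains \<epsilon> where "0 < \<epsilon>" "\<epsilon> \<le> 1"
    "\<And>t. 0 < t \<Longrightarrow> t \<le> \<epsilon> \<Longrightarrow> 1 - pgf \<mu> (1 - t) < 1 - pgf \<nu> (1 - t)"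
proof -
  obtain m where m: "offspring_mean \<mu> = ennreal m" "0 \<le> m"
    using assms by (cases "offspring_mean \<mu>") auto
  have "ennreal m < (SUP N. \<Sum>n<N. of_nat n * ennreal (pmf \<nu> n))"
    using assms unfolding m(1) by (simp add: offspring_mean_def suminf_eq_SUP)
  then obtain N where "ennreal m < (\<Sum>n<N. of_nat n * ennreal (pmf \<nu> n))"
    by (auto simp: less_SUP_iff)
  also have "\<dots> = ennreal (\<Sum>n<N. real n * pmf \<nu> n)"
    by (subst sum_ennreal[symmetric])
      (auto simp: ennreal_mult ennreal_of_nat_eq_real_of_nat)
  finally have N: "m < (\<Sum>n<N. real n * pmf \<nu> n)" (is "_ < ?S")
    using m by (simp add: ennreal_less_iff)
  have "((\<lambda>t::real. (1 - t) ^ N * ?S) \<longlongrightarrow> (1 - 0) ^ N * ?S) (at_right 0)"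
    by (intro tendsto_intros)
  then have "\<forall>\<^sub>F t in at_right 0. m < (1 - t) ^ N * ?S"
    using N by (intro order_tendstoD(1)[where y = "(1 - 0) ^ N * ?S"]) auto
  then obtain b where b: "b > 0" "\<And>t. 0 < t \<Longrightarrow> t < b \<Longrightarrow> m < (1 - t) ^ N * ?S"
    unfolding eventually_at_right_field by auto
  show thesis
  proof
    show "0 < min 1 (b / 2)" "min 1 (b / 2) \<le> 1"
      using b by auto
    fix t :: real assume t: "0 < t" "t \<le> min 1 (b / 2)"
    have "ennreal (1 - pgf \<mu> (1 - t)) \<le> ennreal (t * m)"
      using pgf_upper[of t \<mu>] t m by (simp add: ennreal_mult)
    then have "1 - pgf \<mu> (1 - t) \<le> t * m"
      using t m by simp
    also have "\<dots> < t * ((1 - t) ^ N * ?S)"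
      using t b by (intro mult_strict_left_mono) auto
    also have "\<dots> \<le> 1 - pgf \<nu> (1 - t)"
      using pgf_lower[of t N \<nu>] t by (simp add: mult.assoc)
    finally show "1 - pgf \<mu> (1 - t) < 1 - pgf \<nu> (1 - t)" .
  qed
qed

text \<open>
  The comparison of \<open>\<mu>\<close> with the law of exactly one child, whose deficit is \<open>t\<close> itself.
\<close>

lemma supercritical_germ:
  assumes "supercritical \<mu>"
  obtains \<epsilon> where "0 < \<epsilon>" "\<epsilon> \<le> 1" "\<And>t. 0 < t \<Longrightarrow> t \<le> \<epsilon> \<Longrightarrow> t < 1 - pgf \<mu> (1 - t)"
proof -
  have "offspring_mean (return_pmf 1) = (\<Sum>n. if n = 1 then 1 else 0)"
    unfolding offspring_mean_def by (intro suminf_cong) (auto simp: pmf_return)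
  also have "\<dots> = 1"
    by (subst suminf_finite[of "{1}"]) auto
  finally have "offspring_mean (return_pmf 1) < offspring_mean \<mu>"
    using assms by (simp add: supercritical_def)
  from germ_order[OF this] show thesis
    using that by (simp add: pgf_def) metis
qed

section \<open>Product functionals of the branching process\<close>

abbreviation mset_prod :: "('s \<Rightarrow> real) \<Rightarrow> 's multiset \<Rightarrow> real" where
  "mset_prod h B \<equiv> (\<Prod>x\<in>#B. h x)"

lemma mset_prod_unit:
  assumes "\<And>x. 0 \<le> h x \<and> h x \<le> (1::real)"
  shows "0 \<le> mset_prod h B \<and> mset_prod h B \<le> 1"
  using assms by (induction B) (auto intro: mult_le_one)

lemma nn_integral_replicate_mset_prod:
  assumes h: "\<And>x. 0 \<le> h x \<and> h x \<le> (1::real)"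
  shows "(\<integral>\<^sup>+xs. ennreal (mset_prod h (mset xs)) \<partial>replicate_pmf n p)
      = ennreal (measure_pmf.expectation p h ^ n)"
proof (induction n)
  case (Suc n)
  have "(\<integral>\<^sup>+xs. ennreal (mset_prod h (mset xs)) \<partial>replicate_pmf (Suc n) p)
      = (\<integral>\<^sup>+x. \<integral>\<^sup>+xs. ennreal (h x) * ennreal (mset_prod h (mset xs)) \<partial>replicate_pmf n p \<partial>p)"
    using h mset_prod_unit[of h, OF h] by (simp add: ennreal_mult)
  also have "\<dots> = (\<integral>\<^sup>+x. ennreal (h x) \<partial>p) * ennreal (measure_pmf.expectation p h ^ n)"
    by (simp add: nn_integral_cmult nn_integral_multc Suc)
  also have "\<dots> = ennreal (measure_pmf.expectation p h ^ Suc n)"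
    using h expectation_pmf_unit[of h, OF h] by (simp add: ennreal_expectation_pmf ennreal_mult)
  finally show ?case .
qed simp

text \<open>
  The value at \<open>x\<close> is the mean of the product of \<open>h\<close> over the children of a particle at \<open>x\<close>
  (see \<open>nn_integral_offspring_law\<close>).
\<close>

definition offspring_pgf :: "('s \<Rightarrow> 's pmf) \<Rightarrow> nat pmf \<Rightarrow> ('s \<Rightarrow> real) \<Rightarrow> 's \<Rightarrow> real" where
  "offspring_pgf P \<mu> h x = pgf \<mu> (measure_pmf.expectation (P x) h)"

lemma offspring_pgf_unit:
  assumes "\<And>x. 0 \<le> h x \<and> h x \<le> (1::real)"
  shows "0 \<le> offspring_pgf P \<mu> h x \<and> offspring_pgf P \<mu> h x \<le> 1"
  unfolding offspring_pgf_def
  using expectation_pmf_unit[of h, OF assms] pgf_unit by blast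

lemma nn_integral_offspring_law:
  assumes h: "\<And>x. 0 \<le> h x \<and> h x \<le> (1::real)"
  shows "(\<integral>\<^sup>+B. ennreal (mset_prod h B) \<partial>offspring_law P \<mu> x) = ennreal (offspring_pgf P \<mu> h x)"
  using expectation_pmf_unit[of h, OF h]
  by (simp add: offspring_law_def nn_integral_replicate_mset_prod[OF h] offspring_pgf_def pgf_def
      ennreal_expectation_pmf power_unit)

text \<open>
  The branching property: the particles of \<open>B\<close> reproduce independently, so the mean of a product over
  the next generation is a product over \<open>B\<close>.
\<close>

lemma nn_integral_branching_step:
  assumes h: "\<And>x. 0 \<le> h x \<and> h x \<le> (1::real)"
  shows "(\<integral>\<^sup>+C. ennreal (mset_prod h C) \<partial>branching_step P \<mu> B)
      = ennreal (mset_prod (offspring_pgf P \<mu> h) B)"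
proof (induction B)
  case empty
  then show ?case by (simp add: branching_step_empty)
next
  case (add x B)
  have "(\<integral>\<^sup>+C. ennreal (mset_prod h C) \<partial>branching_step P \<mu> (add_mset x B))
     = (\<integral>\<^sup>+C. \<integral>\<^sup>+D. ennreal (mset_prod h C) * ennreal (mset_prod h D)
          \<partial>branching_step P \<mu> B \<partial>offspring_law P \<mu> x)"
    using mset_prod_unit[of h, OF h]
    by (simp add: branching_step_add_mset add_indep_def nn_integral_pair_pmf' ennreal_mult)
  also have "\<dots> = ennreal (offspring_pgf P \<mu> h x) * ennreal (mset_prod (offspring_pgf P \<mu> h) B)"
    by (simp add: nn_integral_cmult nn_integral_multc add nn_integral_offspring_law[OF h])
  also have "\<dots> = ennreal (mset_prod (offspring_pgf P \<mu> h) (add_mset x B))"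
    using offspring_pgf_unit[of h, OF h] mset_prod_unit[of "offspring_pgf P \<mu> h", OF offspring_pgf_unit[of h, OF h]]
    by (simp add: ennreal_mult)
  finally show ?case .
qed

lemma borel_measurable_coordinate:
  assumes "i \<in> I"
  shows "(\<lambda>B. k (B i)) \<in> borel_measurable (PiM I (\<lambda>_. count_space UNIV))"
  using measurable_component_singleton[OF assms, of "\<lambda>_. count_space UNIV"]
  by (rule measurable_compose) simp

lemma borel_measurable_branching_coord:
  "(\<lambda>B. k (B i)) \<in> borel_measurable (branching_law P \<mu> x)"
  unfolding measurable_cong_sets[OF sets_branching_law refl]
  by (rule borel_measurable_coordinate) simp

text \<open>
  A functional of the first \<open>n\<close> generations can be integrated against the finite-dimensional
  Ionescu-Tulcea measure, which is built up one kernel at a time.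
\<close>

lemma nn_integral_branching_law_initial:
  fixes F :: "(nat \<Rightarrow> 's multiset) \<Rightarrow> ennreal"
  assumes F: "F \<in> borel_measurable (PiM {0..<n} (\<lambda>_. count_space UNIV))"
  shows "(\<integral>\<^sup>+B. F (restrict B {0..<n}) \<partial>branching_law P \<mu> x)
      = (\<integral>\<^sup>+B. F B \<partial>branching.C P \<mu> x 0 n (\<lambda>_. undefined))"
proof -
  have "branching.up_to {0..<n} = n"
    using branching.up_to_iff[of "{0..<n}"]
    by (metis atLeastLessThan_iff branching.up_to_less finite_atLeastLessThan le_antisym
        le_eq_less_or_eq less_imp_le_nat linorder_not_less order_refl zero_le)
  then have "branching.CI P \<mu> x {0..<n} =
      distr (branching.C P \<mu> x 0 n (\<lambda>_. undefined)) (PiM {0..<n} (\<lambda>_. count_space UNIV))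
        (\<lambda>f. restrict f {0..<n})"
    by (simp add: branching.CI_def)
  also have "\<dots> = branching.C P \<mu> x 0 n (\<lambda>_. undefined)"
    using branching.distr_C[of n n "\<lambda>_. undefined" 0 P \<mu> x] by simp
  finally have CI: "branching.CI P \<mu> x {0..<n} = branching.C P \<mu> x 0 n (\<lambda>_. undefined)" .
  have "(\<integral>\<^sup>+B. F B \<partial>branching.CI P \<mu> x {0..<n})
      = (\<integral>\<^sup>+B. F B \<partial>distr (branching_law P \<mu> x) (PiM {0..<n} (\<lambda>_. count_space UNIV))
            (\<lambda>f. restrict f {0..<n}))"
    unfolding branching_law_def by (subst branching.distr_lim) auto
  also have "\<dots> = (\<integral>\<^sup>+B. F (restrict B {0..<n}) \<partial>branching_law P \<mu> x)"
    by (subst nn_integral_distr)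
      (auto intro!: measurable_restrict measurable_component_singleton F
        simp: measurable_cong_sets[OF sets_branching_law refl])
  finally show ?thesis
    by (simp add: CI)
qed

text \<open>
  The Markov property at time \<open>n\<close>: given the first \<open>n + 1\<close> generations, the next one has law
  \<open>branching_step P \<mu> (B n)\<close>.
\<close>

lemma nn_integral_branching_law_Suc:
  fixes f :: "(nat \<Rightarrow> 's multiset) \<Rightarrow> ennreal" and g :: "'s multiset \<Rightarrow> ennreal"
  assumes f: "f \<in> borel_measurable (PiM {0..<Suc n} (\<lambda>_. count_space UNIV))"
  shows "(\<integral>\<^sup>+B. f (restrict B {0..<Suc n}) * g (B (Suc n)) \<partial>branching_law P \<mu> x)
      = (\<integral>\<^sup>+B. f (restrict B {0..<Suc n}) * (\<integral>\<^sup>+C. g C \<partial>branching_step P \<mu> (B n))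
          \<partial>branching_law P \<mu> x)" (is "?L = ?R")
proof -
  let ?M = "\<lambda>n. PiM {0..<n} (\<lambda>_. count_space UNIV) :: (nat \<Rightarrow> 's multiset) measure"
  let ?C = "\<lambda>n. branching.C P \<mu> x 0 n (\<lambda>_. undefined)"
  let ?F = "\<lambda>B. f (restrict B {0..<Suc n}) * g (B (Suc n))"
  let ?G = "\<lambda>B. f B * (\<integral>\<^sup>+C. g C \<partial>branching_step P \<mu> (B n))"
  note comp = borel_measurable_coordinate
  have F: "?F \<in> borel_measurable (?M (Suc (Suc n)))"
    by (intro borel_measurable_times_ennreal comp measurable_compose[OF measurable_restrict_subset f])
      auto
  have G: "?G \<in> borel_measurable (?M (Suc n))"
    by (intro borel_measurable_times_ennreal comp[where k = "\<lambda>D. \<integral>\<^sup>+C. g C \<partial>branching_step P \<mu> D"] f) auto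
  have "?L = (\<integral>\<^sup>+B. ?F (restrict B {0..<Suc (Suc n)}) \<partial>branching_law P \<mu> x)"
    by (intro nn_integral_cong) (simp add: min_def)
  also have "\<dots> = (\<integral>\<^sup>+B. ?F B \<partial>?C (Suc (Suc n)))"
    by (rule nn_integral_branching_law_initial[OF F])
  also have "\<dots> = (\<integral>\<^sup>+B. \<integral>\<^sup>+D. ?F D \<partial>branching.eP P \<mu> x (Suc n) B \<partial>?C (Suc n))"
    using F by (subst branching.C.simps, subst nn_integral_bind[where B = "?M (Suc (Suc n))"])
      (auto simp: measurable_cong_sets[OF branching.sets_C refl] simp del: branching.C.simps
        intro!: branching.measurable_eP)
  also have "\<dots> = (\<integral>\<^sup>+B. ?G B \<partial>?C (Suc n))"
  proof (rule nn_integral_cong)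
    fix B assume "B \<in> space (?C (Suc n))"
    then have B: "B \<in> space (?M (Suc n))"
      by (simp add: branching.space_C del: branching.C.simps)
    then have r: "restrict (B(Suc n := D)) {0..<Suc n} = B" for D
      by (auto simp: space_PiM PiE_def extensional_def fun_eq_iff)
    have "(\<integral>\<^sup>+D. ?F D \<partial>branching.eP P \<mu> x (Suc n) B)
        = (\<integral>\<^sup>+D. ?F (B(Suc n := D)) \<partial>branching_step P \<mu> (B n))"
      using branching.nn_integral_eP[OF B F, of P \<mu> x] by simp
    also have "\<dots> = (\<integral>\<^sup>+D. f B * g D \<partial>branching_step P \<mu> (B n))"
      unfolding r by simp
    also have "\<dots> = ?G B"
      by (simp add: nn_integral_cmult)
    finally show "(\<integral>\<^sup>+D. ?F D \<partial>branching.eP P \<mu> x (Suc n) B) = ?G B" .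
  qed
  also have "\<dots> = (\<integral>\<^sup>+B. ?G (restrict B {0..<Suc n}) \<partial>branching_law P \<mu> x)"
    by (rule nn_integral_branching_law_initial[OF G, symmetric])
  also have "\<dots> = ?R"
    by (intro nn_integral_cong) simp
  finally show ?thesis .
qed

lemma nn_integral_branching_law_0:
  fixes g :: "'s multiset \<Rightarrow> ennreal"
  shows "(\<integral>\<^sup>+B. g (B 0) \<partial>branching_law P \<mu> x) = g {#x#}"
proof -
  let ?M = "\<lambda>n. PiM {0..<n} (\<lambda>_. count_space UNIV) :: (nat \<Rightarrow> 's multiset) measure"
  have F: "(\<lambda>B. g (B 0)) \<in> borel_measurable (?M 1)"
    by (rule borel_measurable_coordinate) simp
  have u: "(\<lambda>_. undefined) \<in> space (?M 0)"
    by (simp add: space_PiM)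
  have "(\<integral>\<^sup>+B. g (B 0) \<partial>branching_law P \<mu> x) = (\<integral>\<^sup>+B. g (restrict B {0..<1} 0) \<partial>branching_law P \<mu> x)"
    by simp
  also have "\<dots> = (\<integral>\<^sup>+B. g (B 0) \<partial>branching.C P \<mu> x 0 1 (\<lambda>_. undefined))"
    by (rule nn_integral_branching_law_initial[OF F])
  also have "branching.C P \<mu> x 0 1 (\<lambda>_. undefined) = branching.eP P \<mu> x 0 (\<lambda>_. undefined)"
    using bind_return[OF branching.measurable_eP[of P \<mu> x 0] u] by simp
  also have "(\<integral>\<^sup>+B. g (B 0) \<partial>branching.eP P \<mu> x 0 (\<lambda>_. undefined)) = g {#x#}"
    using F by (subst branching.nn_integral_eP[OF u]) auto
  finally show ?thesis .
qed

text \<open>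
  If a particle at \<open>x\<close> survives its own visit with probability \<open>a x\<close>, this is the probability that it
  does so and that all its children succeed, where a child at \<open>y\<close> succeeds with probability \<open>h y\<close>.
\<close>

definition killed_step ::
    "('s \<Rightarrow> 's pmf) \<Rightarrow> nat pmf \<Rightarrow> ('s \<Rightarrow> real) \<Rightarrow> ('s \<Rightarrow> real) \<Rightarrow> 's \<Rightarrow> real" where
  "killed_step P \<mu> a h x = a x * offspring_pgf P \<mu> h x"

lemma killed_step_unit:
  assumes "\<And>x. 0 \<le> a x \<and> a x \<le> (1::real)" "\<And>x. 0 \<le> h x \<and> h x \<le> 1"
  shows "0 \<le> killed_step P \<mu> a h x \<and> killed_step P \<mu> a h x \<le> 1"
  unfolding killed_step_def
  using assms(1)[of x] offspring_pgf_unit[of h, OF assms(2)] by (auto intro: mult_le_one)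

text \<open>
  Conditioning on all but the last generation replaces the test function \<open>h\<close> at time \<open>n + 1\<close> by
  \<open>killed_step P \<mu> a h\<close> at time \<open>n\<close>; this is why \<open>h\<close> has to be arbitrary in the induction.
\<close>

lemma nn_integral_branching_law_prod:
  assumes a: "\<And>x. 0 \<le> a x \<and> a x \<le> (1::real)" and h: "\<And>x. 0 \<le> h x \<and> h x \<le> 1"
  shows "(\<integral>\<^sup>+B. ennreal ((\<Prod>k<n. mset_prod a (B k)) * mset_prod h (B n)) \<partial>branching_law P \<mu> x)
      = ennreal ((killed_step P \<mu> a ^^ n) h x)"
  using h
proof (induction n arbitrary: h)
  case 0
  then show ?case
    using nn_integral_branching_law_0[where g = "\<lambda>B. ennreal (mset_prod h B)"] by simp
next
  case (Suc n)
  note h = Suc.prems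
  let ?p = "\<lambda>m B. \<Prod>k<m. mset_prod a (B k)"
  have p: "0 \<le> ?p m B" for m and B :: "nat \<Rightarrow> 'a multiset"
    using mset_prod_unit[of a, OF a] by (intro prod_nonneg) auto
  have [simp]: "?p m (restrict B {0..<m}) = ?p m B" for m and B :: "nat \<Rightarrow> 'a multiset"
    by (intro prod.cong) auto
  have meas: "(\<lambda>B. ennreal (?p (Suc n) B)) \<in> borel_measurable (PiM {0..<Suc n} (\<lambda>_. count_space UNIV))"
    by (intro measurable_compose[OF _ measurable_ennreal] borel_measurable_prod
        borel_measurable_coordinate[where k = "mset_prod a"]) auto
  have "(\<integral>\<^sup>+B. ennreal (?p (Suc n) B * mset_prod h (B (Suc n))) \<partial>branching_law P \<mu> x)
      = (\<integral>\<^sup>+B. ennreal (?p (Suc n) (restrict B {0..<Suc n})) * ennreal (mset_prod h (B (Suc n)))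
          \<partial>branching_law P \<mu> x)"
    using p[of _ "Suc n"] mset_prod_unit[of h, OF h]
    by (intro nn_integral_cong, subst ennreal_mult[symmetric]) (auto simp del: prod.lessThan_Suc)
  also have "\<dots> = (\<integral>\<^sup>+B. ennreal (?p (Suc n) (restrict B {0..<Suc n}))
          * (\<integral>\<^sup>+C. ennreal (mset_prod h C) \<partial>branching_step P \<mu> (B n)) \<partial>branching_law P \<mu> x)"
    by (rule nn_integral_branching_law_Suc[OF meas])
  also have "\<dots> = (\<integral>\<^sup>+B. ennreal (?p n B * mset_prod (killed_step P \<mu> a h) (B n)) \<partial>branching_law P \<mu> x)"
  proof (intro nn_integral_cong)
    fix B :: "nat \<Rightarrow> 'a multiset"
    have "mset_prod (killed_step P \<mu> a h) (B n) = mset_prod a (B n) * mset_prod (offspring_pgf P \<mu> h) (B n)"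
      by (simp add: killed_step_def prod_mset.distrib)
    moreover have "ennreal (?p (Suc n) (restrict B {0..<Suc n})) = ennreal (?p (Suc n) B)"
      by (simp only: \<open>?p (Suc n) (restrict B {0..<Suc n}) = ?p (Suc n) B\<close>)
    ultimately show "ennreal (?p (Suc n) (restrict B {0..<Suc n}))
          * (\<integral>\<^sup>+C. ennreal (mset_prod h C) \<partial>branching_step P \<mu> (B n))
        = ennreal (?p n B * mset_prod (killed_step P \<mu> a h) (B n))"
      using p mset_prod_unit[of a, OF a] mset_prod_unit[of "offspring_pgf P \<mu> h", OF offspring_pgf_unit[of h, OF h]]
      by (simp add: nn_integral_branching_step[OF h] ennreal_mult[symmetric] mult.assoc)
  qed
  also have "\<dots> = ennreal ((killed_step P \<mu> a ^^ n) (killed_step P \<mu> a h) x)"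
    by (rule Suc.IH) (rule killed_step_unit[OF a h])
  finally show ?case
    by (simp add: funpow_swap1)
qed

text \<open>
  The trajectory space contains paths that revive after dying out, so absorption at the empty
  configuration holds only almost surely.
\<close>

lemma AE_extinction_absorbing:
  "AE B in branching_law P \<mu> x. \<forall>n. B n = {#} \<longrightarrow> B (Suc n) = {#}"
  unfolding AE_all_countable
proof
  fix n
  let ?f = "\<lambda>B :: nat \<Rightarrow> 'a multiset. indicator {{#}} (B n) :: ennreal"
  let ?g = "indicator (- {{#}}) :: 'a multiset \<Rightarrow> ennreal"
  have "?f \<in> borel_measurable (PiM {0..<Suc n} (\<lambda>_. count_space UNIV))"
    by (rule borel_measurable_coordinate) simp
  from nn_integral_branching_law_Suc[OF this, where g = ?g and P = P and \<mu> = \<mu> and x = x]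
  have "(\<integral>\<^sup>+B. ?f B * ?g (B (Suc n)) \<partial>branching_law P \<mu> x) =
     (\<integral>\<^sup>+B. ?f B * emeasure (branching_step P \<mu> (B n)) (- {{#}}) \<partial>branching_law P \<mu> x)"
    by simp
  also have "\<dots> = (\<integral>\<^sup>+B. 0 \<partial>branching_law P \<mu> x)"
    by (intro nn_integral_cong)
      (auto simp: branching_step_empty indicator_def emeasure_return_pmf)
  finally have "(\<integral>\<^sup>+B. ?f B * ?g (B (Suc n)) \<partial>branching_law P \<mu> x) = 0"
    by simp
  moreover have "(\<lambda>B. ?f B * ?g (B (Suc n))) \<in> borel_measurable (branching_law P \<mu> x)"
    by (intro borel_measurable_times_ennreal borel_measurable_branching_coord[where k = "indicator {{#}}"]
        borel_measurable_branching_coord[where k = ?g])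
  ultimately have "AE B in branching_law P \<mu> x. ?f B * ?g (B (Suc n)) = 0"
    by (simp add: nn_integral_0_iff_AE)
  then show "AE B in branching_law P \<mu> x. B n = {#} \<longrightarrow> B (Suc n) = {#}"
    by eventually_elim (auto simp: indicator_def split: if_splits)
qed

section \<open>Total visits as a limit\<close>

definition visits :: "'s set \<Rightarrow> (nat \<Rightarrow> 's multiset) \<Rightarrow> nat \<Rightarrow> nat" where
  "visits A B n = (\<Sum>k<n. size (filter_mset (\<lambda>a. a \<in> A) (B k)))"

lemma size_filter_mset_conv_sum:
  assumes "finite F" "A \<inter> set_mset B \<subseteq> F" "F \<subseteq> A"
  shows "size (filter_mset (\<lambda>a. a \<in> A) B) = (\<Sum>a\<in>F. count B a)"
proof -
  have "size (filter_mset (\<lambda>a. a \<in> A) B) = (\<Sum>a\<in>A \<inter> set_mset B. count B a)"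
    unfolding size_multiset_overloaded_eq by (intro sum.cong) auto
  also have "\<dots> = (\<Sum>a\<in>F. count B a)"
    using assms by (intro sum.mono_neutral_left) (auto simp: not_in_iff)
  finally show ?thesis .
qed

lemma sum_count_le_size_filter_mset:
  assumes "finite F" "F \<subseteq> A"
  shows "(\<Sum>a\<in>F. count B a) \<le> size (filter_mset (\<lambda>a. a \<in> A) B)"
proof -
  let ?H = "F \<union> (A \<inter> set_mset B)"
  have "size (filter_mset (\<lambda>a. a \<in> A) B) = (\<Sum>a\<in>?H. count B a)"
    using assms by (intro size_filter_mset_conv_sum) auto
  then show ?thesis
    using assms by (auto intro: sum_mono2)
qed

text \<open>
  Exchange of the sum over \<open>A\<close> with the sum over time; up to a finite time only finitely many states
  are occupied, so finite subsets of \<open>A\<close> suffice.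
\<close>

lemma total_visits_eq_SUP: "total_visits A B = (SUP n. of_nat (visits A B n))"
proof -
  let ?s = "\<lambda>k. size (filter_mset (\<lambda>a. a \<in> A) (B k))"
  have tv: "total_visits A B = (SUP F\<in>{F. finite F \<and> F \<subseteq> A}. \<Sum>a\<in>F. \<Sum>n. of_nat (count (B n) a))"
    unfolding total_visits_def by (rule nonneg_infsum_complete) simp
  have sup: "(SUP n. of_nat (visits A B n) :: ennreal) = (\<Sum>k. of_nat (?s k))"
    by (simp add: visits_def suminf_eq_SUP)
  show ?thesis
  proof (rule antisym)
    show "total_visits A B \<le> (SUP n. of_nat (visits A B n))"
      unfolding tv sup
    proof (rule SUP_least)
      fix F assume F: "F \<in> {F. finite F \<and> F \<subseteq> A}"
      have "(\<Sum>a\<in>F. \<Sum>n. of_nat (count (B n) a) :: ennreal) = (\<Sum>n. \<Sum>a\<in>F. of_nat (count (B n) a))"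
        by (rule suminf_sum[symmetric]) auto
      also have "\<dots> \<le> (\<Sum>k. of_nat (?s k))"
      proof (intro suminf_le allI)
        show "(\<Sum>a\<in>F. of_nat (count (B n) a) :: ennreal) \<le> of_nat (?s n)" for n
          using sum_count_le_size_filter_mset[of F A "B n"] F
          by (simp flip: of_nat_sum)
      qed auto
      finally show "(\<Sum>a\<in>F. \<Sum>n. of_nat (count (B n) a) :: ennreal) \<le> (\<Sum>k. of_nat (?s k))" .
    qed
    show "(SUP n. of_nat (visits A B n)) \<le> total_visits A B"
    proof (rule SUP_least)
      fix n
      let ?F = "A \<inter> (\<Union>k<n. set_mset (B k))"
      have "of_nat (visits A B n) = (\<Sum>k<n. \<Sum>a\<in>?F. of_nat (count (B k) a) :: ennreal)"
        unfolding visits_def of_nat_sum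
      proof (rule sum.cong)
        show "of_nat (?s k) = (\<Sum>a\<in>?F. of_nat (count (B k) a) :: ennreal)" if "k \<in> {..<n}" for k
          by (subst size_filter_mset_conv_sum[of ?F]) (use that in auto)
      qed simp
      also have "\<dots> = (\<Sum>a\<in>?F. \<Sum>k<n. of_nat (count (B k) a))"
        by (rule sum.swap)
      also have "\<dots> \<le> (\<Sum>a\<in>?F. \<Sum>k. of_nat (count (B k) a))"
        by (intro sum_mono sum_le_suminf) auto
      also have "\<dots> \<le> total_visits A B"
        unfolding tv by (intro SUP_upper) auto
      finally show "of_nat (visits A B n) \<le> total_visits A B" .
    qed
  qed
qed

lemma visits_mono: "m \<le> n \<Longrightarrow> visits A B m \<le> visits A B n"
  unfolding visits_def by (intro sum_mono2) auto

lemma total_visits_finite_iff: "total_visits A B \<noteq> \<infinity> \<longleftrightarrow> (\<exists>K. \<forall>n. visits A B n \<le> K)"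
proof
  assume "total_visits A B \<noteq> \<infinity>"
  then obtain r where r: "total_visits A B = ennreal r" "0 \<le> r"
    by (cases "total_visits A B") auto
  have "visits A B n \<le> nat \<lfloor>r\<rfloor>" for n
  proof -
    have "of_nat (visits A B n) \<le> ennreal r"
      unfolding r(1)[symmetric] total_visits_eq_SUP by (rule SUP_upper) simp
    then show ?thesis
      using r(2) by (simp add: ennreal_of_nat_eq_real_of_nat le_nat_floor)
  qed
  then show "\<exists>K. \<forall>n. visits A B n \<le> K" by blast
next
  assume "\<exists>K. \<forall>n. visits A B n \<le> K"
  then obtain K where "\<And>n. visits A B n \<le> K" by blast
  then have "total_visits A B \<le> of_nat K"
    unfolding total_visits_eq_SUP by (intro SUP_least) simp
  then show "total_visits A B \<noteq> \<infinity>"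
    by (auto simp: top_unique)
qed

text \<open>
  This is \<open>q ^ total_visits A B\<close> with the convention \<open>q ^ \<infinity> = 0\<close>, for \<open>0 < q < 1\<close>.
\<close>

definition discounted :: "real \<Rightarrow> 's set \<Rightarrow> (nat \<Rightarrow> 's multiset) \<Rightarrow> real" where
  "discounted q A B = lim (\<lambda>n. q ^ visits A B n)"

lemma visits_eventually_const:
  assumes "total_visits A B \<noteq> \<infinity>"
  obtains K where "\<forall>\<^sub>F n in sequentially. visits A B n = K"
proof -
  obtain K where "\<And>n. visits A B n \<le> K"
    using assms unfolding total_visits_finite_iff by blast
  then have fin: "finite (range (visits A B))"
    by (auto intro: finite_subset[of _ "{..K}"])
  have "Max (range (visits A B)) \<in> range (visits A B)"
    using Max_in[OF fin] by simp
  then obtain N where N: "Max (range (visits A B)) = visits A B N"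
    by (rule rangeE)
  have "visits A B n = visits A B N" if "n \<ge> N" for n
    using visits_mono[OF that, of A B] Max_ge[OF fin rangeI, of n] unfolding N by (rule antisym[rotated])
  then have "\<forall>\<^sub>F n in sequentially. visits A B n = visits A B N"
    unfolding eventually_sequentially by blast
  then show thesis
    by (rule that)
qed

lemma visits_power_tendsto_0:
  assumes "total_visits A B = \<infinity>" and "0 < q" "q < (1::real)"
  shows "(\<lambda>n. q ^ visits A B n) \<longlonglongrightarrow> 0"
proof -
  have "filterlim (visits A B) at_top sequentially"
    unfolding filterlim_at_top
  proof
    fix K
    obtain N where "\<not> visits A B N \<le> K"
      using assms(1) total_visits_finite_iff[of A B] by blast
    then have "visits A B n \<ge> K" if "n \<ge> N" for n
      using visits_mono[OF that, of A B] by simp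
    then show "\<forall>\<^sub>F n in sequentially. K \<le> visits A B n"
      by (auto simp: eventually_sequentially)
  qed
  then show ?thesis
    using filterlim_compose[OF LIMSEQ_realpow_zero[of q]] assms by simp
qed

lemma discounted_tendsto:
  assumes "0 < q" "q < 1"
  shows "(\<lambda>n. q ^ visits A B n) \<longlonglongrightarrow> discounted q A B"
proof (cases "total_visits A B = \<infinity>")
  case True
  then show ?thesis
    using visits_power_tendsto_0[OF True assms] by (simp add: discounted_def limI)
next
  case False
  then obtain K where "\<forall>\<^sub>F n in sequentially. visits A B n = K"
    by (rule visits_eventually_const)
  then have "(\<lambda>n. q ^ visits A B n) \<longlonglongrightarrow> q ^ K"
    by (intro tendsto_eventually) (auto elim: eventually_mono)
  then show ?thesis
    by (simp add: discounted_def limI)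
qed

lemma discounted_unit:
  assumes "0 < q" "q < 1"
  shows "0 \<le> discounted q A B \<and> discounted q A B \<le> 1"
proof
  show "0 \<le> discounted q A B"
    by (rule LIMSEQ_le_const[OF discounted_tendsto[OF assms]]) (use assms in auto)
  show "discounted q A B \<le> 1"
    by (rule LIMSEQ_le_const2[OF discounted_tendsto[OF assms]])
      (use assms in \<open>auto simp: power_le_one\<close>)
qed

text \<open>
  A sequence of discount factors; any sequence in the open unit interval with limit 1 would do.
\<close>

definition toward_one :: "nat \<Rightarrow> real" where
  "toward_one j = 1 - 1 / real (j + 2)"

lemma toward_one: "0 < toward_one j" "toward_one j < 1" "toward_one \<longlonglongrightarrow> 1"
proof -
  show "0 < toward_one j" "toward_one j < 1"
    by (auto simp: toward_one_def field_simps)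
  have "(\<lambda>j. 1 - 1 / real (j + 2)) \<longlonglongrightarrow> 1 - 0"
    by (intro tendsto_diff tendsto_const LIMSEQ_ignore_initial_segment[OF lim_1_over_n])
  then show "toward_one \<longlonglongrightarrow> 1"
    by (simp add: toward_one_def[abs_def])
qed

text \<open>
  The point of discounting: a finite number of visits is forgotten as the discount factor tends to 1,
  an infinite number is not.
\<close>

lemma discounted_toward_one_tendsto:
  "(\<lambda>j. discounted (toward_one j) A B) \<longlonglongrightarrow> indicator {B. total_visits A B \<noteq> \<infinity>} B"
proof (cases "total_visits A B = \<infinity>")
  case True
  have "discounted (toward_one j) A B = 0" for j
    using visits_power_tendsto_0[OF True toward_one(1,2)] by (simp add: discounted_def limI)
  then show ?thesis
    using True by simp
next
  case False
  then obtain K where K: "\<forall>\<^sub>F n in sequentially. visits A B n = K"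
    by (rule visits_eventually_const)
  have "discounted q A B = q ^ K" for q
    unfolding discounted_def
    by (intro limI tendsto_eventually) (use K in \<open>auto elim: eventually_mono\<close>)
  moreover have "(\<lambda>j. toward_one j ^ K) \<longlonglongrightarrow> 1 ^ K"
    by (intro tendsto_power toward_one)
  ultimately show ?thesis
    using False by simp
qed

section \<open>Fixed-point equations for the number of visits\<close>

definition kill_weight :: "real \<Rightarrow> 's set \<Rightarrow> 's \<Rightarrow> real" where
  "kill_weight q A x = (if x \<in> A then q else 1)"

lemma kill_weight_unit: "0 < q \<Longrightarrow> q < 1 \<Longrightarrow> 0 \<le> kill_weight q A x \<and> kill_weight q A x \<le> 1"
  by (simp add: kill_weight_def)

lemma mset_prod_kill_weight: "mset_prod (kill_weight q A) B = q ^ size (filter_mset (\<lambda>a. a \<in> A) B)"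
  by (induction B) (auto simp: kill_weight_def)

lemma borel_measurable_visits_power:
  "(\<lambda>B. q ^ visits A B n :: real) \<in> borel_measurable (branching_law P \<mu> x)"
proof -
  have "(\<lambda>B. \<Prod>k<n. q ^ size (filter_mset (\<lambda>a. a \<in> A) (B k)) :: real)
      \<in> borel_measurable (branching_law P \<mu> x)"
    by (intro borel_measurable_prod
        borel_measurable_branching_coord[where k = "\<lambda>C. q ^ size (filter_mset (\<lambda>a. a \<in> A) C)"])
  then show ?thesis
    by (simp add: visits_def power_sum)
qed

lemma borel_measurable_discounted:
  assumes "0 < q" "q < 1"
  shows "discounted q A \<in> borel_measurable (branching_law P \<mu> x)"
  using borel_measurable_visits_power discounted_tendsto[OF assms]
  by (rule borel_measurable_LIMSEQ_real[rotated -1])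

definition discounted_mean ::
    "('s \<Rightarrow> 's pmf) \<Rightarrow> nat pmf \<Rightarrow> real \<Rightarrow> 's set \<Rightarrow> 's \<Rightarrow> real" where
  "discounted_mean P \<mu> q A x = integral\<^sup>L (branching_law P \<mu> x) (discounted q A)"

lemma killed_iterates_unit:
  assumes "0 < q" "q < 1"
  shows "0 \<le> (killed_step P \<mu> (kill_weight q A) ^^ n) (\<lambda>_. 1) x
     \<and> (killed_step P \<mu> (kill_weight q A) ^^ n) (\<lambda>_. 1) x \<le> 1"
proof (induction n arbitrary: x)
  case (Suc n)
  then show ?case
    using killed_step_unit[of "kill_weight q A", OF kill_weight_unit[OF assms] Suc.IH] by simp
qed simp

text \<open>
  The product of the weights over all particles of the first \<open>n\<close> generations is \<open>q\<close> raised to the number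
  of visits to \<open>A\<close> before time \<open>n\<close>.
\<close>

lemma integral_visits_power:
  assumes "0 < q" "q < 1"
  shows "(\<integral>B. q ^ visits A B n \<partial>branching_law P \<mu> x)
      = (killed_step P \<mu> (kill_weight q A) ^^ n) (\<lambda>_. 1) x"
proof -
  note w = kill_weight_unit[OF assms, of A]
  have "(\<integral>\<^sup>+B. ennreal (q ^ visits A B n) \<partial>branching_law P \<mu> x)
      = ennreal ((killed_step P \<mu> (kill_weight q A) ^^ n) (\<lambda>_. 1) x)"
    using nn_integral_branching_law_prod[where a = "kill_weight q A" and h = "\<lambda>_. 1"
        and n = n and P = P and \<mu> = \<mu> and x = x, OF w]
    by (simp add: mset_prod_kill_weight visits_def power_sum)
  moreover have "0 \<le> (killed_step P \<mu> (kill_weight q A) ^^ n) (\<lambda>_. 1) x"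
    by (rule killed_iterates_unit[OF assms, THEN conjunct1])
  ultimately show ?thesis
    using assms borel_measurable_visits_power by (subst integral_eq_nn_integral) auto
qed

lemma killed_iterates_tendsto:
  assumes "0 < q" "q < 1"
  shows "(\<lambda>n. (killed_step P \<mu> (kill_weight q A) ^^ n) (\<lambda>_. 1) x) \<longlonglongrightarrow> discounted_mean P \<mu> q A x"
proof -
  interpret prob_space "branching_law P \<mu> x"
    by (rule prob_space_branching_law)
  show ?thesis
    unfolding discounted_mean_def integral_visits_power[OF assms, symmetric]
    using assms discounted_tendsto[OF assms]
    by (intro integral_dominated_convergence[where w = "\<lambda>_. 1"]
        borel_measurable_visits_power borel_measurable_discounted) (auto simp: power_le_one)
qed

lemma discounted_mean_unit:
  assumes "0 < q" "q < 1"
  shows "0 \<le> discounted_mean P \<mu> q A x \<and> discounted_mean P \<mu> q A x \<le> 1"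
proof -
  note lim = killed_iterates_tendsto[OF assms, of P \<mu> A x]
  show ?thesis
    using LIMSEQ_le_const[OF lim, of 0] LIMSEQ_le_const2[OF lim, of 1]
      killed_iterates_unit[OF assms, of _ P \<mu> A x] by blast
qed

lemma offspring_pgf_tendsto:
  assumes "\<And>n x. 0 \<le> h n x \<and> h n x \<le> (1::real)" "\<And>x. (\<lambda>n. h n x) \<longlonglongrightarrow> g x"
  shows "(\<lambda>n. offspring_pgf P \<mu> (h n) x) \<longlonglongrightarrow> offspring_pgf P \<mu> g x"
  unfolding offspring_pgf_def
  using expectation_pmf_unit[of "h _", OF assms(1)]
  by (intro pgf_tendsto expectation_pmf_tendsto assms) auto

lemma discounted_mean_fixpoint:
  assumes "0 < q" "q < 1"
  shows "discounted_mean P \<mu> q A x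
      = kill_weight q A x * offspring_pgf P \<mu> (discounted_mean P \<mu> q A) x"
proof -
  let ?F = "\<lambda>n. (killed_step P \<mu> (kill_weight q A) ^^ n) (\<lambda>_. 1)"
  have "(\<lambda>n. kill_weight q A x * offspring_pgf P \<mu> (?F n) x)
      \<longlonglongrightarrow> kill_weight q A x * offspring_pgf P \<mu> (discounted_mean P \<mu> q A) x"
    by (intro tendsto_mult tendsto_const offspring_pgf_tendsto killed_iterates_unit
        killed_iterates_tendsto assms)
  moreover have "(\<lambda>n. ?F (Suc n) x) \<longlonglongrightarrow> discounted_mean P \<mu> q A x"
    by (intro LIMSEQ_Suc killed_iterates_tendsto assms)
  ultimately show ?thesis
    by (auto simp: killed_step_def intro: LIMSEQ_unique)
qed

definition finite_visits_prob :: "('s::countable \<Rightarrow> 's pmf) \<Rightarrow> nat pmf \<Rightarrow> 's set \<Rightarrow> 's \<Rightarrow> real" where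
  "finite_visits_prob P \<mu> A x = \<P>(B in branching_law P \<mu> x. total_visits A B \<noteq> \<infinity>)"

lemma prob_infinite_visits:
  fixes A :: "'s::countable set"
  shows "\<P>(B in branching_law P \<mu> x. total_visits A B = \<infinity>) = 1 - finite_visits_prob P \<mu> A x"
proof -
  interpret prob_space "branching_law P \<mu> x"
    by (rule prob_space_branching_law)
  show ?thesis
    unfolding finite_visits_prob_def
    by (subst prob_neg) auto
qed

lemma finite_visits_prob_unit: "0 \<le> finite_visits_prob P \<mu> A x \<and> finite_visits_prob P \<mu> A x \<le> 1"
  unfolding finite_visits_prob_def
  using prob_space.prob_le_1[OF prob_space_branching_law] by simp

lemma discounted_mean_tendsto:
  fixes A :: "'s::countable set"
  shows "(\<lambda>j. discounted_mean P \<mu> (toward_one j) A x) \<longlonglongrightarrow> finite_visits_prob P \<mu> A x"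
proof -
  interpret prob_space "branching_law P \<mu> x"
    by (rule prob_space_branching_law)
  let ?E = "{B. total_visits A B \<noteq> \<infinity>}"
  have E: "{B \<in> space (branching_law P \<mu> x). total_visits A B \<noteq> \<infinity>} \<in> events"
    by measurable
  have "(\<lambda>j. discounted_mean P \<mu> (toward_one j) A x)
      \<longlonglongrightarrow> integral\<^sup>L (branching_law P \<mu> x) (indicator ?E)"
    unfolding discounted_mean_def
    using discounted_unit[OF toward_one(1,2)] E
    by (intro integral_dominated_convergence[where w = "\<lambda>_. 1"] borel_measurable_discounted
        toward_one borel_measurable_indicator' AE_I2 discounted_toward_one_tendsto)
      (auto simp: toward_one abs_le_iff intro: order_trans[of _ 0])
  also have "integral\<^sup>L (branching_law P \<mu> x) (indicator ?E) = finite_visits_prob P \<mu> A x"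
    unfolding finite_visits_prob_def
    by (simp add: Int_def conj_commute)
  finally show ?thesis .
qed

text \<open>
  The number of visits is infinite exactly if some child of the initial particle has infinitely many
  visits among its descendants. The equation is obtained as the limit of the discounted one, whose weight
  on \<open>A\<close> tends to 1.
\<close>

lemma finite_visits_prob_fixpoint:
  "finite_visits_prob P \<mu> A x = offspring_pgf P \<mu> (finite_visits_prob P \<mu> A) x"
proof -
  let ?F = "\<lambda>j. discounted_mean P \<mu> (toward_one j) A"
  have "(\<lambda>j. kill_weight (toward_one j) A x) \<longlonglongrightarrow> 1"
    using toward_one(3) by (cases "x \<in> A") (auto simp: kill_weight_def)
  then have "(\<lambda>j. kill_weight (toward_one j) A x * offspring_pgf P \<mu> (?F j) x)
      \<longlonglongrightarrow> 1 * offspring_pgf P \<mu> (finite_visits_prob P \<mu> A) x"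
    by (intro tendsto_mult offspring_pgf_tendsto discounted_mean_unit
        discounted_mean_tendsto toward_one)
  then have "(\<lambda>j. ?F j x) \<longlonglongrightarrow> offspring_pgf P \<mu> (finite_visits_prob P \<mu> A) x"
    by (simp flip: discounted_mean_fixpoint[OF toward_one(1,2)])
  then show ?thesis
    using discounted_mean_tendsto LIMSEQ_unique by blast
qed

text \<open>
  Survival puts at least one visit to \<open>UNIV\<close> into every generation; after extinction there are none.
\<close>

lemma AE_survives_iff:
  fixes P :: "'s::countable \<Rightarrow> 's pmf"
  shows "AE B in branching_law P \<mu> x. survives B \<longleftrightarrow> total_visits UNIV B = \<infinity>"
  using AE_extinction_absorbing
proof eventually_elim
  case (elim B)
  show ?case
  proof
    assume B: "survives B"
    have "n \<le> visits UNIV B n" for n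
    proof -
      have "(\<Sum>k<n. 1) \<le> visits UNIV B n"
        unfolding visits_def using B by (intro sum_mono) (auto simp: survives_def Suc_le_eq)
      then show ?thesis by simp
    qed
    then show "total_visits UNIV B = \<infinity>"
      by (meson total_visits_finite_iff not_less_eq_eq order_trans)
  next
    assume inf: "total_visits UNIV B = \<infinity>"
    show "survives B"
      unfolding survives_def
    proof (rule ccontr)
      assume "\<not> (\<forall>n. 0 < size (B n))"
      then obtain N where N: "B N = {#}" by auto
      have dead: "B n = {#}" if "N \<le> n" for n
        using that by (induction rule: dec_induct) (use elim N in auto)
      have "visits UNIV B n \<le> visits UNIV B N" for n
      proof (cases "n \<le> N")
        case False
        have "visits UNIV B n = visits UNIV B N"
          unfolding visits_def
          using False dead by (intro sum.mono_neutral_right) auto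
        then show ?thesis by simp
      qed (simp add: visits_mono)
      then show False
        using inf total_visits_finite_iff[of UNIV B] by blast
    qed
  qed
qed

lemma total_visits_mono: "A \<subseteq> A' \<Longrightarrow> total_visits A B \<le> total_visits A' B"
  unfolding total_visits_eq_SUP visits_def
  by (intro SUP_mono') (auto intro!: sum_mono size_mset_mono filter_mset_mono_strong)

section \<open>Comparison of the two offspring laws\<close>

text \<open>
  One step of the comparison at a single state, where \<open>u\<close> and \<open>v\<close> are the averages over the next
  position of the two probabilities of being killed. If \<open>v > \<epsilon>\<close>, then the right-hand side is at
  least \<open>\<delta>\<close> and the bound is trivial. If \<open>v \<le> \<epsilon>\<close>, then \<open>pgf_scale\<close> reduces \<open>u \<le> v / \<delta>\<close> to \<open>v\<close> itself at the
  cost of a factor \<open>1 / \<delta>\<close>, and \<open>\<mu>\<close> and \<open>\<nu>\<close> are compared at \<open>v\<close>.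
\<close>

lemma germ_scalar_comparison:
  assumes \<epsilon>: "0 < \<epsilon>" "\<epsilon> \<le> 1"
    and germ: "\<And>t. 0 < t \<Longrightarrow> t \<le> \<epsilon> \<Longrightarrow> 1 - pgf \<mu> (1 - t) < 1 - pgf \<nu> (1 - t)"
    and \<delta>: "\<delta> = 1 - pgf \<nu> (1 - \<epsilon>)"
    and a: "0 \<le> a" "a \<le> 1" and u: "0 \<le> u" "u \<le> 1" and v: "0 \<le> v" "v \<le> 1" and uv: "\<delta> * u \<le> v"
  shows "\<delta> * (1 - a * pgf \<mu> (1 - u)) \<le> 1 - a * pgf \<nu> (1 - v)"
proof -
  have G: "0 \<le> pgf \<xi> (1 - t)" "pgf \<xi> (1 - t) \<le> 1" if "0 \<le> t" "t \<le> 1" for \<xi> t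
    using pgf_unit[of "1 - t" \<xi>] that by auto
  have \<delta>_bounds: "0 < \<delta>" "\<delta> \<le> 1"
    using germ[of \<epsilon>] G[of \<epsilon>] \<epsilon> \<delta> by (smt (verit))+
  have "\<delta> * (1 - pgf \<mu> (1 - u)) \<le> 1 - pgf \<nu> (1 - v)"
  proof (cases "v \<le> \<epsilon>")
    case False
    have "\<delta> * (1 - pgf \<mu> (1 - u)) \<le> \<delta> * 1"
      using G[OF u] \<delta>_bounds by (intro mult_left_mono) auto
    also have "\<dots> \<le> 1 - pgf \<nu> (1 - v)"
      unfolding \<delta> using pgf_mono[of "1 - v" "1 - \<epsilon>" \<nu>] False v \<epsilon> by simp
    finally show ?thesis .
  next
    case True
    show ?thesis
    proof (cases "v = 0")
      case True
      then have "u = 0"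
        using uv u \<delta>_bounds by (simp add: mult_le_0_iff)
      then show ?thesis
        using True by simp
    next
      case False
      \<comment> \<open>The factor that carries \<open>v\<close> to \<open>v / \<delta>\<close>, cut off so that \<open>1 - c * v\<close> stays in the unit interval.\<close>
      define c where "c = min 1 (v / \<delta>) / v"
      have c: "1 \<le> c" "c * v \<le> 1" "c \<le> 1 / \<delta>" "u \<le> c * v"
        using False v u uv \<delta>_bounds unfolding c_def by (auto simp: field_simps min_def)
      have "1 - pgf \<mu> (1 - u) \<le> 1 - pgf \<mu> (1 - c * v)"
        using pgf_mono[of "1 - c * v" "1 - u" \<mu>] c u by simp
      also have "\<dots> \<le> c * (1 - pgf \<mu> (1 - v))"
        using pgf_scale[of v c \<mu>] c v by simp
      also have "\<dots> \<le> (1 / \<delta>) * (1 - pgf \<nu> (1 - v))"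
        using c germ[of v] \<open>v \<le> \<epsilon>\<close> False v G[OF v] \<delta>_bounds by (intro mult_mono) auto
      finally show ?thesis
        using \<delta>_bounds by (simp add: field_simps)
    qed
  qed
  then have "a * (\<delta> * (1 - pgf \<mu> (1 - u))) \<le> a * (1 - pgf \<nu> (1 - v))"
    using a by (intro mult_left_mono)
  moreover have "\<delta> * (1 - a) \<le> 1 * (1 - a)"
    using a \<delta>_bounds by (intro mult_right_mono) auto
  ultimately show ?thesis
    by (simp add: algebra_simps)
qed

text \<open>
  The bound \<open>\<delta> * U \<le> V\<close> is inherited by every iterate of the \<open>\<mu>\<close>-iteration, because \<open>V\<close> comes from a
  fixed point of the \<open>\<nu>\<close>-iteration. As \<open>\<delta>\<close> depends on the two offspring laws only, it survives the limits
  \<open>n \<rightarrow> \<infinity>\<close> and \<open>q \<rightarrow> 1\<close>, in this order.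
\<close>

lemma infinite_visits_comparison:
  fixes P :: "'s::countable \<Rightarrow> 's pmf"
  assumes "offspring_mean \<mu> < offspring_mean \<nu>"
  obtains \<delta> where "0 < \<delta>"
    "\<And>A x. \<delta> * (1 - finite_visits_prob P \<mu> A x) \<le> 1 - finite_visits_prob P \<nu> A x"
proof -
  obtain \<epsilon> where \<epsilon>: "0 < \<epsilon>" "\<epsilon> \<le> 1"
    and germ: "\<And>t. 0 < t \<Longrightarrow> t \<le> \<epsilon> \<Longrightarrow> 1 - pgf \<mu> (1 - t) < 1 - pgf \<nu> (1 - t)"
    using germ_order[OF assms] by blast
  define \<delta> where "\<delta> = 1 - pgf \<nu> (1 - \<epsilon>)"
  have \<delta>: "0 < \<delta>" "\<delta> \<le> 1"
    using germ[of \<epsilon>] pgf_unit[of "1 - \<epsilon>" \<mu>] pgf_unit[of "1 - \<epsilon>" \<nu>] \<epsilon> \<delta>_def by auto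
  have step: "\<delta> * (1 - (killed_step P \<mu> (kill_weight q A) ^^ n) (\<lambda>_. 1) x) \<le> 1 - discounted_mean P \<nu> q A x"
    if q: "0 < q" "q < 1" for q A n x
  proof (induction n arbitrary: x)
    case 0
    then show ?case
      using discounted_mean_unit[OF q, of P \<nu> A x] by simp
  next
    case (Suc n)
    let ?f = "(killed_step P \<mu> (kill_weight q A) ^^ n) (\<lambda>_. 1)" and ?g = "discounted_mean P \<nu> q A"
    let ?u = "1 - measure_pmf.expectation (P x) ?f" and ?v = "1 - measure_pmf.expectation (P x) ?g"
    note f = killed_iterates_unit[OF q, of n P \<mu> A] and g = discounted_mean_unit[OF q, of P \<nu> A]
    have "measure_pmf.expectation (P x) ?g \<le> measure_pmf.expectation (P x) (\<lambda>y. (1 - \<delta>) + \<delta> * ?f y)"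
    proof (rule expectation_pmf_mono)
      fix y
      show "0 \<le> ?g y" using g by blast
      show "?g y \<le> (1 - \<delta>) + \<delta> * ?f y" using Suc.IH[of y] by (simp add: algebra_simps)
      show "(1 - \<delta>) + \<delta> * ?f y \<le> 1"
        using mult_left_mono[of "?f y" 1 \<delta>] f[of y] \<delta> by simp
    qed
    also have "\<dots> = (1 - \<delta>) + \<delta> * measure_pmf.expectation (P x) ?f"
      using integrable_pmf_unit[of ?f "P x", OF f] by simp
    finally have uv: "\<delta> * ?u \<le> ?v"
      by (simp add: algebra_simps)
    have "\<delta> * (1 - kill_weight q A x * pgf \<mu> (1 - ?u)) \<le> 1 - kill_weight q A x * pgf \<nu> (1 - ?v)"
      using kill_weight_unit[OF q, of A x] expectation_pmf_unit[of ?f "P x", OF f]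
        expectation_pmf_unit[of ?g "P x", OF g]
      by (intro germ_scalar_comparison[OF \<epsilon> germ \<delta>_def _ _ _ _ _ _ uv]) auto
    also have "\<dots> = 1 - ?g x"
      using discounted_mean_fixpoint[OF q, of P \<nu> A x] by (simp add: offspring_pgf_def)
    finally show ?case
      by (simp add: killed_step_def[of P \<mu> _ ?f] offspring_pgf_def[of P \<mu> ?f])
  qed
  have lim1: "\<delta> * (1 - discounted_mean P \<mu> q A x) \<le> 1 - discounted_mean P \<nu> q A x"
    if q: "0 < q" "q < 1" for q A x
  proof (rule LIMSEQ_le_const2)
    show "(\<lambda>n. \<delta> * (1 - (killed_step P \<mu> (kill_weight q A) ^^ n) (\<lambda>_. 1) x))
        \<longlonglongrightarrow> \<delta> * (1 - discounted_mean P \<mu> q A x)"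
      by (intro tendsto_intros killed_iterates_tendsto q)
  qed (use step[OF q] in blast)
  show thesis
  proof
    show "\<delta> * (1 - finite_visits_prob P \<mu> A x) \<le> 1 - finite_visits_prob P \<nu> A x" for A x
    proof (rule LIMSEQ_le)
      show "(\<lambda>j. \<delta> * (1 - discounted_mean P \<mu> (toward_one j) A x))
          \<longlonglongrightarrow> \<delta> * (1 - finite_visits_prob P \<mu> A x)"
        by (intro tendsto_intros discounted_mean_tendsto)
      show "(\<lambda>j. 1 - discounted_mean P \<nu> (toward_one j) A x) \<longlonglongrightarrow> 1 - finite_visits_prob P \<nu> A x"
        by (intro tendsto_intros discounted_mean_tendsto)
    qed (use lim1 toward_one in blast)
  qed (rule \<delta>)
qed

section \<open>Uniqueness of fixed points bounded away from 1\<close>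

text \<open>
  Monotonicity of \<open>pgf \<mu>\<close> turns an inequality between functions on the state space into a scalar one for
  the supremum; the next lemma is its counterpart for the infimum.
\<close>

lemma subinvariant_sup:
  fixes f :: "'s \<Rightarrow> real"
  assumes "\<And>x. 0 \<le> f x" "\<And>x. f x \<le> b" "b \<le> 1" "\<And>x. f x \<le> offspring_pgf P \<mu> f x"
  obtains s where "\<And>x. f x \<le> s" "0 \<le> s" "s \<le> b" "s \<le> pgf \<mu> s"
proof
  let ?s = "SUP x. f x"
  have bdd: "bdd_above (range f)"
    using assms(2) by (intro bdd_aboveI[of _ b]) auto
  show le: "f x \<le> ?s" for x
    by (intro cSUP_upper bdd) auto
  show "0 \<le> ?s"
    using assms(1) le order_trans by blast
  show s: "?s \<le> b"
    using assms(2) by (intro cSUP_least) auto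
  show "?s \<le> pgf \<mu> ?s"
  proof (rule cSUP_least)
    fix x
    have f: "0 \<le> f y \<and> f y \<le> 1" for y
      using assms(1-3) order_trans by blast
    have "measure_pmf.expectation (P x) f \<le> measure_pmf.expectation (P x) (\<lambda>_. ?s)"
      using assms(1) le s assms(3) by (intro expectation_pmf_mono) auto
    then have "offspring_pgf P \<mu> f x \<le> pgf \<mu> ?s"
      unfolding offspring_pgf_def using s assms(3) expectation_pmf_unit[of f, OF f]
      by (intro pgf_mono) auto
    then show "f x \<le> pgf \<mu> ?s"
      using assms(4) order_trans by blast
  qed simp
qed

lemma superinvariant_inf:
  fixes g :: "'s \<Rightarrow> real"
  assumes "\<And>x. 0 \<le> g x \<and> g x \<le> 1" "\<And>x. offspring_pgf P \<mu> g x \<le> g x"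
  obtains m where "\<And>x. m \<le> g x" "0 \<le> m" "m \<le> 1" "pgf \<mu> m \<le> m"
proof
  let ?m = "INF x. g x"
  have bdd: "bdd_below (range g)"
    using assms(1) by (intro bdd_belowI[of _ 0]) auto
  show le: "?m \<le> g x" for x
    by (intro cINF_lower bdd) auto
  show m: "0 \<le> ?m" "?m \<le> 1"
    using assms(1) le order_trans by (blast intro: cINF_greatest)+
  show "pgf \<mu> ?m \<le> ?m"
  proof (rule cINF_greatest)
    fix x
    have "?m \<le> measure_pmf.expectation (P x) g"
      using assms(1) le m by (intro expectation_pmf_ge_const) auto
    then have "pgf \<mu> ?m \<le> offspring_pgf P \<mu> g x"
      unfolding offspring_pgf_def using m expectation_pmf_unit[of g, OF assms(1)]
      by (intro pgf_mono) auto
    then show "pgf \<mu> ?m \<le> g x"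
      using assms(2) order_trans by blast
  qed simp
qed

text \<open>
  Let \<open>s\<close> be the supremum of \<open>f\<close> and \<open>m\<close> the infimum of \<open>g\<close>. If \<open>m < s\<close>, then \<open>s\<close> lies strictly between \<open>m\<close>,
  where \<open>pgf \<mu> m \<le> m\<close>, and a point close to 1, where \<open>pgf \<mu>\<close> is strictly below the identity by
  supercriticality. Convexity then gives \<open>pgf \<mu> s < s\<close>, which a supremum of a subinvariant function
  excludes.
\<close>

lemma supercritical_subinvariant_le_superinvariant:
  fixes f g :: "'s \<Rightarrow> real"
  assumes "supercritical \<mu>"
    and f: "\<And>x. 0 \<le> f x" "\<And>x. f x \<le> b" "b < 1" "\<And>x. f x \<le> offspring_pgf P \<mu> f x"
    and g: "\<And>x. 0 \<le> g x \<and> g x \<le> 1" "\<And>x. offspring_pgf P \<mu> g x \<le> g x"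
  shows "f x \<le> g x"
proof -
  obtain \<epsilon> where \<epsilon>: "0 < \<epsilon>" "\<epsilon> \<le> 1" "\<And>t. 0 < t \<Longrightarrow> t \<le> \<epsilon> \<Longrightarrow> t < 1 - pgf \<mu> (1 - t)"
    using supercritical_germ[OF assms(1)] by blast
  obtain s where s: "\<And>x. f x \<le> s" "0 \<le> s" "s \<le> b" "s \<le> pgf \<mu> s"
    using subinvariant_sup[of f b P \<mu>] f by (metis less_imp_le)
  obtain m where m: "\<And>x. m \<le> g x" "0 \<le> m" "m \<le> 1" "pgf \<mu> m \<le> m"
    using superinvariant_inf[of g P \<mu>] g by blast
  have "s \<le> m"
  proof (rule ccontr)
    assume "\<not> s \<le> m"
    \<comment> \<open>Makes \<open>1 - t\<close> a point above \<open>s\<close> at which the generating function is below the identity.\<close>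
    define t where "t = min \<epsilon> ((1 - s) / 2)"
    have t: "0 < t" "t \<le> \<epsilon>" "s < 1 - t"
      using \<epsilon> s(3) f(3) unfolding t_def by (auto simp: min_def field_simps)
    define l where "l = (s - m) / (1 - t - m)"
    have l: "0 < l" "l < 1" and sl: "(1 - l) *\<^sub>R m + l *\<^sub>R (1 - t) = s"
    proof -
      have "1 - t - m > 0"
        using \<open>\<not> s \<le> m\<close> t by simp
      then have "l * (1 - t - m) = s - m"
        by (simp add: l_def)
      then show "(1 - l) *\<^sub>R m + l *\<^sub>R (1 - t) = s"
        by (simp add: algebra_simps)
      show "0 < l" "l < 1"
        using \<open>\<not> s \<le> m\<close> t by (auto simp: l_def field_simps)
    qed
    have "pgf \<mu> s \<le> (1 - l) * pgf \<mu> m + l * pgf \<mu> (1 - t)"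
      unfolding sl[symmetric] using l m t \<epsilon> by (intro convex_onD[OF pgf_convex]) auto
    also have "\<dots> < (1 - l) * m + l * (1 - t)"
      using l m(4) \<epsilon>(3)[OF t(1,2)] by (intro add_le_less_mono mult_left_mono mult_strict_left_mono) auto
    also have "\<dots> = s"
      using sl by simp
    finally show False
      using s(4) by simp
  qed
  then show ?thesis
    using s(1)[of x] m(1)[of x] by linarith
qed

text \<open>
  Discounting every visit bounds the mean by \<open>q < 1\<close>. But there is no supremum of a subinvariant
  function in the open interval from \<open>1 - \<epsilon>\<close> to 1, where \<open>pgf \<mu>\<close> is below the identity. So the bound
  improves to \<open>1 - \<epsilon>\<close>, uniformly in \<open>q\<close>.
\<close>

lemma supercritical_survival:
  fixes P :: "'s::countable \<Rightarrow> 's pmf"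
  assumes "supercritical \<mu>"
  obtains \<epsilon> where "0 < \<epsilon>" "\<And>x. finite_visits_prob P \<mu> UNIV x \<le> 1 - \<epsilon>"
proof -
  obtain \<epsilon> where \<epsilon>: "0 < \<epsilon>" "\<epsilon> \<le> 1" "\<And>t. 0 < t \<Longrightarrow> t \<le> \<epsilon> \<Longrightarrow> t < 1 - pgf \<mu> (1 - t)"
    using supercritical_germ[OF assms] by blast
  have le: "discounted_mean P \<mu> q UNIV x \<le> 1 - \<epsilon>" if q: "0 < q" "q < 1" for q x
  proof -
    let ?f = "discounted_mean P \<mu> q UNIV"
    note f = discounted_mean_unit[OF q, of P \<mu> UNIV]
    have fix_eq: "?f y = q * offspring_pgf P \<mu> ?f y" for y
      using discounted_mean_fixpoint[OF q, of P \<mu> UNIV y] by (simp add: kill_weight_def)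
    have "?f y \<le> q" "?f y \<le> offspring_pgf P \<mu> ?f y" for y
      using fix_eq[of y] offspring_pgf_unit[of ?f P \<mu> y, OF f] q
        mult_left_mono[of "offspring_pgf P \<mu> ?f y" 1 q] mult_right_mono[of q 1 "offspring_pgf P \<mu> ?f y"]
      by auto
    then obtain s where s: "\<And>y. ?f y \<le> s" "0 \<le> s" "s \<le> q" "s \<le> pgf \<mu> s"
      using subinvariant_sup[of ?f q P \<mu>] f q by (metis less_imp_le)
    have "s \<le> 1 - \<epsilon>"
      using \<epsilon>(3)[of "1 - s"] s q by (cases "s \<le> 1 - \<epsilon>") auto
    then show ?thesis
      using s(1)[of x] by linarith
  qed
  show thesis
  proof
    show "finite_visits_prob P \<mu> UNIV x \<le> 1 - \<epsilon>" for x
      by (rule LIMSEQ_le_const2[OF discounted_mean_tendsto]) (use le toward_one in blast)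
  qed (rule \<epsilon>)
qed

section \<open>Transience and recurrence\<close>

lemma prob_survives:
  fixes P :: "'s::countable \<Rightarrow> 's pmf"
  shows "\<P>(B in branching_law P \<mu> x. survives B) = 1 - finite_visits_prob P \<mu> UNIV x"
proof -
  interpret prob_space "branching_law P \<mu> x"
    by (rule prob_space_branching_law)
  have "\<P>(B in branching_law P \<mu> x. survives B) = \<P>(B in branching_law P \<mu> x. total_visits UNIV B = \<infinity>)"
    by (rule prob_eq_AE) (use AE_survives_iff in auto)
  then show ?thesis
    by (simp only: prob_infinite_visits)
qed

lemma prob_infinite_visits_survives:
  fixes P :: "'s::countable \<Rightarrow> 's pmf"
  shows "\<P>(B in branching_law P \<mu> x. total_visits A B = \<infinity> \<and> survives B) = 1 - finite_visits_prob P \<mu> A x"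
proof -
  interpret prob_space "branching_law P \<mu> x"
    by (rule prob_space_branching_law)
  have "total_visits A B = \<infinity> \<Longrightarrow> total_visits UNIV B = \<infinity>" for B
    using total_visits_mono[of A UNIV B] by (simp add: top_unique)
  then have "\<P>(B in branching_law P \<mu> x. total_visits A B = \<infinity> \<and> survives B)
      = \<P>(B in branching_law P \<mu> x. total_visits A B = \<infinity>)"
    by (intro prob_eq_AE) (use AE_survives_iff[of P \<mu> x] in \<open>auto elim!: eventually_mono\<close>)
  then show ?thesis
    by (simp only: prob_infinite_visits)
qed

lemma transient_set_iff: "transient_set P \<mu> A \<longleftrightarrow> (\<forall>x. finite_visits_prob P \<mu> A x = 1)"
  by (simp only: transient_set_def prob_infinite_visits) auto

lemma recurrent_set_iff:
  fixes P :: "'s::countable \<Rightarrow> 's pmf"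
  shows "recurrent_set P \<mu> A \<longleftrightarrow> (\<forall>x. finite_visits_prob P \<mu> UNIV x < 1
      \<and> finite_visits_prob P \<mu> A x = finite_visits_prob P \<mu> UNIV x)"
  unfolding recurrent_set_def cond_prob_def prob_survives prob_infinite_visits_survives
  using finite_visits_prob_unit[of P \<mu>]
  by (simp add: divide_eq_1_iff less_le) metis

text \<open>
  A zero-one law: if infinitely many visits have probability bounded below over all starting points, then
  they happen almost surely on survival.
\<close>

lemma finite_visits_prob_eq_extinction:
  fixes P :: "'s::countable \<Rightarrow> 's pmf"
  assumes "supercritical \<mu>" and "b < 1" and "\<And>x. finite_visits_prob P \<mu> A x \<le> b"
  shows "finite_visits_prob P \<mu> A x = finite_visits_prob P \<mu> UNIV x"
proof (rule antisym)
  note unit = finite_visits_prob_unit[of P \<mu>]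
  note sub = eq_refl[OF finite_visits_prob_fixpoint]
    and super = eq_refl[OF finite_visits_prob_fixpoint[symmetric]]
  show "finite_visits_prob P \<mu> A x \<le> finite_visits_prob P \<mu> UNIV x"
    by (rule supercritical_subinvariant_le_superinvariant
        [OF assms(1) unit[THEN conjunct1] assms(3,2) sub unit super])
  obtain \<epsilon> where \<epsilon>: "0 < \<epsilon>" "\<And>x. finite_visits_prob P \<mu> UNIV x \<le> 1 - \<epsilon>"
    using supercritical_survival[OF assms(1)] by blast
  then have "1 - \<epsilon> < 1" by simp
  then show "finite_visits_prob P \<mu> UNIV x \<le> finite_visits_prob P \<mu> A x"
    by (rule supercritical_subinvariant_le_superinvariant
        [OF assms(1) unit[THEN conjunct1] \<epsilon>(2) _ sub unit super])
qed

theorem theorem1p1: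
  fixes P :: "'s::countable \<Rightarrow> 's pmf" and \<mu> \<nu> :: "nat pmf"
  assumes "supercritical \<mu>" and "supercritical \<nu>"
    and "offspring_mean \<mu> < offspring_mean \<nu>"
  shows "(\<forall>A. transient_set P \<nu> A \<longrightarrow> transient_set P \<mu> A) \<and>
         (\<forall>A. recurrent_set P \<mu> A \<longrightarrow> recurrent_set P \<nu> A)"
proof (intro conjI allI impI)
  fix A
  obtain \<delta> where \<delta>: "0 < \<delta>"
    "\<And>A x. \<delta> * (1 - finite_visits_prob P \<mu> A x) \<le> 1 - finite_visits_prob P \<nu> A x"
    using infinite_visits_comparison[OF assms(3)] by blast
  {
    assume "transient_set P \<nu> A"
    then have "\<delta> * (1 - finite_visits_prob P \<mu> A x) \<le> 0" for x
      using \<delta>(2)[of A x] by (simp add: transient_set_iff)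
    then have "1 \<le> finite_visits_prob P \<mu> A x" for x
      using \<delta>(1) by (simp add: mult_le_0_iff)
    then show "transient_set P \<mu> A"
      using finite_visits_prob_unit[of P \<mu> A] by (simp add: transient_set_iff order_eq_iff)
  next
    assume rec: "recurrent_set P \<mu> A"
    obtain \<epsilon> where \<epsilon>: "0 < \<epsilon>" "\<And>x. finite_visits_prob P \<mu> UNIV x \<le> 1 - \<epsilon>"
      using supercritical_survival[OF assms(1)] by blast
    have "finite_visits_prob P \<nu> A x \<le> 1 - \<delta> * \<epsilon>" for x
    proof -
      have "\<delta> * \<epsilon> \<le> \<delta> * (1 - finite_visits_prob P \<mu> A x)"
        using rec \<epsilon>(2)[of x] \<delta>(1) by (intro mult_left_mono) (auto simp: recurrent_set_iff)
      then show ?thesis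
        using \<delta>(2)[of A x] by linarith
    qed
    then have "finite_visits_prob P \<nu> A x = finite_visits_prob P \<nu> UNIV x" for x
      using \<delta>(1) \<epsilon>(1) by (intro finite_visits_prob_eq_extinction[OF assms(2), where b = "1 - \<delta> * \<epsilon>"]) auto
    moreover obtain \<epsilon>' where "0 < \<epsilon>'" "\<And>x. finite_visits_prob P \<nu> UNIV x \<le> 1 - \<epsilon>'"
      using supercritical_survival[OF assms(2)] by blast
    then have "finite_visits_prob P \<nu> UNIV x < 1" for x
      by (meson diff_less_eq le_less_trans less_add_same_cancel1)
    ultimately show "recurrent_set P \<nu> A"
      by (simp add: recurrent_set_iff)
  }
qed

end
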